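(* Let $A$ be an $n\times n$ complex matrix such that $f=\det(\operatorname{diag}(x_1,\dots,x_n)+A)$ is real stable. Then: (a) If $f$ is irreducible, then $A$ is diagonally equivalent to an irreducible Hermitian matrix with the same principal minors as $A$. (b) If $f$ factors as $f=f_1\cdots f_s$ where each factor $f_i$ is irreducible, normalized so that its top-degree multiaffine monomial has coefficient $1$, then $A$ can be written, after permuting some rows and the corresponding columns, as a block upper triangular matrix with $s$ diagonal blocks that are irreducible, that are diagonally equivalent to irreducible Hermitian matrices, and whose determinantal polynomials are equal to the irreducible factors $f_1,\dots,f_s$ of $f$ (in some order).
   Context: A polynomial $f\in\mathbb{R}[x_1,\dots,x_n]$ is real stable if it has no zero $(z_1,\dots,z_n)\in\mathbb{C}^n$ with $\operatorname{Im} z_k>0$ for all $k$; "$f$ is real stable" includes that $f$ has real coefficients. Irreducibility of polynomials is in $\mathbb{C}[x_1,\dots,x_n]$. The determinantal polynomial of the diagonal block of $A$ with row and column index set $T\subseteq[n]$ is $\det(\operatorname{diag}(x_k:k\in T)+A[T,T])$, where $A[T,T]$ is the principal submatrix on $T$. Two complex matrices $A,B$ are diagonally equivalent if there is an invertible complex diagonal matrix $D$ with $A=DBD^{-1}$ or $A=DB^TD^{-1}$. A matrix is reducible if, after permuting some rows and the corresponding columns by the same permutation, it is block upper triangular with at least two (square, nonempty) diagonal blocks; otherwise it is irreducible. The principal minors of $A$ are $\det A[S,S]$, $S\subseteq[n]$. *)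

theory Defs
  imports
    "HOL-Library.Poly_Mapping"
    "HOL-Combinatorics.Permutations"
    "Jordan_Normal_Form.Determinant"
    "Jordan_Normal_Form.DL_Submatrix"
    "Jordan_Normal_Form.Schur_Decomposition"
begin

text \<open>
  Indices are 0-based: matrix rows and columns, and variables, are numbered by \<open>{..<n}\<close>.
  A monomial is its finitely supported exponent vector, a polynomial a finitely supported
  map from monomials to coefficients.
\<close>

type_synonym mpoly = "(nat \<Rightarrow>\<^sub>0 nat) \<Rightarrow>\<^sub>0 complex"

definition X :: "nat \<Rightarrow> mpoly" where
  "X k = Poly_Mapping.single (Poly_Mapping.single k 1) 1"

definition Const :: "complex \<Rightarrow> mpoly" where
  "Const c = Poly_Mapping.single 0 c"

text \<open>The type \<open>mpoly\<close> has countably many variables; \<open>mpolys n\<close> is the subring of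
  polynomials in the first \<open>n\<close> of them.\<close>

definition mpolys :: "nat \<Rightarrow> mpoly set" where
  "mpolys n = {p. \<forall>m\<in>Poly_Mapping.keys p. Poly_Mapping.keys m \<subseteq> {..<n}}"

definition eval_mpoly :: "(nat \<Rightarrow> complex) \<Rightarrow> mpoly \<Rightarrow> complex" where
  "eval_mpoly z p = (\<Sum>m\<in>Poly_Mapping.keys p.
     Poly_Mapping.lookup p m * (\<Prod>k\<in>Poly_Mapping.keys m. z k ^ Poly_Mapping.lookup m k))"

definition real_stable :: "nat \<Rightarrow> mpoly \<Rightarrow> bool" where
  "real_stable n f \<longleftrightarrow>
     f \<in> mpolys n \<and>
     (\<forall>m. Poly_Mapping.lookup f m \<in> \<real>) \<and>
     (\<forall>z. (\<forall>k<n. Im (z k) > 0) \<longrightarrow> eval_mpoly z f \<noteq> 0)"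

definition mpoly_unit :: "nat \<Rightarrow> mpoly \<Rightarrow> bool" where
  "mpoly_unit n a \<longleftrightarrow> a \<in> mpolys n \<and> (\<exists>b\<in>mpolys n. a * b = 1)"

text \<open>This is \<^const>\<open>irreducible\<close> relativised to the ring \<open>mpolys n\<close>.\<close>

definition mpoly_irreducible :: "nat \<Rightarrow> mpoly \<Rightarrow> bool" where
  "mpoly_irreducible n p \<longleftrightarrow>
     p \<in> mpolys n \<and> p \<noteq> 0 \<and> \<not> mpoly_unit n p \<and>
     (\<forall>a\<in>mpolys n. \<forall>b\<in>mpolys n. p = a * b \<longrightarrow> mpoly_unit n a \<or> mpoly_unit n b)"

definition monom_degree :: "(nat \<Rightarrow>\<^sub>0 nat) \<Rightarrow> nat" where
  "monom_degree m = (\<Sum>k\<in>Poly_Mapping.keys m. Poly_Mapping.lookup m k)"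

text \<open>Some multiaffine monomial of top total degree occurs with coefficient 1. For factors of
  \<open>det (diag x + A)\<close>, whose only monomial of degree \<open>n\<close> is the product of all variables, the
  monomial of top degree is unique and multiaffine.\<close>

definition top_normalized :: "mpoly \<Rightarrow> bool" where
  "top_normalized p \<longleftrightarrow>
     (\<exists>m\<in>Poly_Mapping.keys p.
        (\<forall>k. Poly_Mapping.lookup m k \<le> 1) \<and>
        (\<forall>m'\<in>Poly_Mapping.keys p. monom_degree m' \<le> monom_degree m) \<and>
        Poly_Mapping.lookup p m = 1)"

definition diag_plus :: "complex mat \<Rightarrow> mpoly mat" where
  "diag_plus A = mat_diag (dim_row A) X + map_mat Const A"

text \<open>For \<open>T \<subseteq> {..<n}\<close> this is the determinant of \<open>diag (x\<^sub>k : k \<in> T) + A[T,T]\<close>: the variables keep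
  the indices they have in the full matrix.\<close>

definition det_poly :: "complex mat \<Rightarrow> nat set \<Rightarrow> mpoly" where
  "det_poly A T = det (submatrix (diag_plus A) T T)"

definition hermitian_mat :: "complex mat \<Rightarrow> bool" where
  "hermitian_mat A \<longleftrightarrow> square_mat A \<and> mat_adjoint A = A"

definition diag_equiv :: "complex mat \<Rightarrow> complex mat \<Rightarrow> bool" where
  "diag_equiv A B \<longleftrightarrow>
     (\<exists>n D D'. A \<in> carrier_mat n n \<and> B \<in> carrier_mat n n \<and>
        D \<in> carrier_mat n n \<and> D' \<in> carrier_mat n n \<and>
        diagonal_mat D \<and> inverts_mat D D' \<and> inverts_mat D' D \<and>
        (A = D * B * D' \<or> A = D * transpose_mat B * D'))"

definition permute_mat :: "(nat \<Rightarrow> nat) \<Rightarrow> complex mat \<Rightarrow> complex mat" where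
  "permute_mat \<pi> A = mat (dim_row A) (dim_col A) (\<lambda>(i,j). A $$ (\<pi> i, \<pi> j))"

text \<open>The index range of the \<open>p\<close>-th diagonal block, when the blocks have sizes \<open>ns\<close>.\<close>

definition block_range :: "nat list \<Rightarrow> nat \<Rightarrow> nat set" where
  "block_range ns p = {sum_list (take p ns)..<sum_list (take (Suc p) ns)}"

definition block_upper_triangular :: "nat list \<Rightarrow> complex mat \<Rightarrow> bool" where
  "block_upper_triangular ns A \<longleftrightarrow>
     A \<in> carrier_mat (sum_list ns) (sum_list ns) \<and>
     (\<forall>m\<in>set ns. 0 < m) \<and>
     (\<forall>p<length ns. \<forall>q<p. \<forall>i\<in>block_range ns p. \<forall>j\<in>block_range ns q. A $$ (i,j) = 0)"

definition reducible_mat :: "complex mat \<Rightarrow> bool" where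
  "reducible_mat A \<longleftrightarrow>
     (\<exists>\<pi> ns. \<pi> permutes {..<dim_row A} \<and> 2 \<le> length ns \<and>
        block_upper_triangular ns (permute_mat \<pi> A))"

definition irreducible_mat :: "complex mat \<Rightarrow> bool" where
  "irreducible_mat A \<longleftrightarrow> square_mat A \<and> \<not> reducible_mat A"

end

theory Submission
  imports Defs
begin

text \<open>
  Write \<open>a\<close> for the entries of \<open>A\<close> and \<open>f\<^sub>S = det (diag x + A[S,S])\<close>. Conjugating \<open>A\<close> by a diagonal
  matrix \<open>D\<close> gives a Hermitian matrix as soon as there are positive reals \<open>p\<^sub>i\<close> (namely \<open>\<bar>D\<^sub>i\<^sub>i\<bar>\<^sup>2\<close>)
  with \<open>a\<^sub>i\<^sub>j p\<^sub>j = p\<^sub>i cnj a\<^sub>j\<^sub>i\<close>; this condition is called \<open>hermitizable\<close> below.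

  Real stability enters through the Rayleigh inequality
  \<open>f\<^sub>S f\<^bsub>S-{i,j}\<^esub> \<le> f\<^bsub>S-{i}\<^esub> f\<^bsub>S-{j}\<^esub>\<close> at real points: if it failed at a real point, \<open>f = 0\<close> solved for \<open>x\<^sub>i\<close>
  would be a Moebius map of \<open>x\<^sub>j\<close> that preserves the upper half plane, and moving the other variables
  slightly upwards would produce a forbidden zero (\<open>stable_imp_rayleigh_inequality\<close>). The inequality,
  together with reality of the principal minors, passes to principal submatrices and to Schur
  complements with respect to a real value of one variable, and for two indices it
  says \<open>a\<^sub>i\<^sub>j a\<^sub>j\<^sub>i \<ge> 0\<close>.

  The heart is \<open>rayleigh_imp_hermitizable\<close>: if moreover the digraph of \<open>A\<close> is strongly connected, then
  \<open>A\<close> is hermitizable. By induction on the number of indices, eliminate an index \<open>k\<close>: the Schur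
  complements \<open>a\<^sub>i\<^sub>j - s a\<^sub>i\<^sub>k a\<^sub>k\<^sub>j\<close>, \<open>s\<close> real, satisfy the same inequalities, and for generic \<open>s\<close> contracting \<open>k\<close>
  keeps the digraph strongly connected, so one of them is hermitizable with weights \<open>p\<close>. The product of
  the \<open>(i,j)\<close> and \<open>(j,i)\<close> entries is nonnegative for every real \<open>s\<close>, so the roots in \<open>s\<close> of these two linear
  factors are complex conjugates (\<open>nonneg_pencil\<close>). Hence \<open>p\<close> serves the constant and the linear coefficients
  separately, and the relation for the coefficients \<open>a\<^sub>i\<^sub>k a\<^sub>k\<^sub>j\<close> determines the missing weight \<open>p\<^sub>k\<close>.

  If \<open>f\<close> is irreducible then \<open>A\<close> is strongly connected, because a vanishing block would split the
  determinant; this gives (a). For (b), \<open>f\<close> is multiaffine, so the factors \<open>f\<^sub>q\<close> involve disjoint sets of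
  variables \<open>V\<^sub>q\<close>, and comparing coefficients shows that \<open>f\<^sub>q\<close> is the determinantal polynomial of
  \<open>A[V\<^sub>q,V\<^sub>q]\<close> and that \<open>a\<^sub>i\<^sub>j a\<^sub>j\<^sub>i = 0\<close> for \<open>i\<close>, \<open>j\<close> in different \<open>V\<^sub>q\<close> (\<open>factor_of_det_poly\<close>). A strongly connected union
  of several \<open>V\<^sub>q\<close> would be hermitizable, hence would have a symmetric zero pattern, which
  contradicts \<open>a\<^sub>i\<^sub>j a\<^sub>j\<^sub>i = 0\<close>. So the \<open>V\<^sub>q\<close> are the strong components of \<open>A\<close> and can be sorted topologically, which
  is block triangular form.
\<close>

section \<open>Determinants over finite index sets\<close>

text \<open>Principal submatrices keep the names of their indices here, which avoids renumbering when
  indices are deleted or eliminated.\<close>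

definition pdet :: "nat set \<Rightarrow> (nat \<Rightarrow> nat \<Rightarrow> 'a) \<Rightarrow> 'a :: comm_ring_1" where
  "pdet S m = (\<Sum>\<pi> | \<pi> permutes S. signof \<pi> * (\<Prod>i\<in>S. m i (\<pi> i)))"

definition add_diag :: "(nat \<Rightarrow> nat \<Rightarrow> 'a) \<Rightarrow> (nat \<Rightarrow> 'a) \<Rightarrow> nat \<Rightarrow> nat \<Rightarrow> 'a :: comm_ring_1" where
  "add_diag a x i j = a i j + (if i = j then x i else 0)"

lemma pdet_cong:
  assumes "\<And>i j. i \<in> S \<Longrightarrow> j \<in> S \<Longrightarrow> m i j = m' i j"
  shows "pdet S m = pdet S m'"
  unfolding pdet_def by (intro sum.cong prod.cong arg_cong2[where f="(*)"] refl assms)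
    (auto simp: permutes_in_image)

lemma pdet_empty [simp]: "pdet {} m = 1"
  by (simp add: pdet_def)

text \<open>Renaming indices conjugates the permutations in the Leibniz sum and preserves their signs.\<close>

lemma pdet_reindex:
  assumes "bij_betw h R S" "finite R"
  shows "pdet S m = pdet R (\<lambda>i j. m (h i) (h j))"
proof -
  have inj: "inj_on h R" and im: "h ` R = S" using assms by (auto simp: bij_betw_def)
  have eq: "(\<lambda>\<pi> x. if x \<in> S then h (\<pi> (inv_into R h x)) else x) = map_permutation R h"
    by (auto simp: fun_eq_iff map_permutation_def restrict_id_def im)
  have bij: "bij_betw (map_permutation R h) {\<pi>. \<pi> permutes R} {\<pi>. \<pi> permutes S}"
    using bij_betw_permutations[OF assms(1)] by (simp add: eq)
  have "pdet S m = (\<Sum>\<pi> | \<pi> permutes R. signof (map_permutation R h \<pi>) *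
      (\<Prod>i\<in>S. m i (map_permutation R h \<pi> i)))"
    unfolding pdet_def using sum.reindex_bij_betw[OF bij] by (rule sym)
  also have "\<dots> = pdet R (\<lambda>i j. m (h i) (h j))"
    unfolding pdet_def
  proof (rule sum.cong[OF refl], clarify)
    fix \<pi> assume p: "\<pi> permutes R"
    have "(\<Prod>i\<in>S. m i (map_permutation R h \<pi> i)) = (\<Prod>i\<in>R. m (h i) (map_permutation R h \<pi> (h i)))"
      using prod.reindex_bij_betw[OF assms(1)] by (rule sym)
    then show "signof (map_permutation R h \<pi>) * (\<Prod>i\<in>S. m i (map_permutation R h \<pi> i))
        = signof \<pi> * (\<Prod>i\<in>R. m (h i) (h (\<pi> i)))"
      using sign_map_permutation[OF inj p assms(2)]
      by (simp add: map_permutation_apply[OF inj])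
  qed
  finally show ?thesis .
qed

lemma det_eq_pdet:
  assumes "M \<in> carrier_mat n n"
  shows "det M = pdet {..<n} (\<lambda>i j. M $$ (i, j))"
  using assms by (simp add: det_def' pdet_def lessThan_atLeast0)

lemma pdet_eq_det:
  assumes "bij_betw h {..<n} S"
  shows "pdet S m = det (mat n n (\<lambda>(i, j). m (h i) (h j)))"
  by (subst det_eq_pdet[OF mat_carrier], subst pdet_reindex[OF assms])
    (auto intro!: pdet_cong)

lemma bij_betw_pick:
  assumes "finite T"
  shows "bij_betw (pick T) {..<card T} T"
proof -
  have inj: "inj_on (pick T) {..<card T}"
    by (rule linorder_inj_onI') (use pick_mono_le[of _ T] in \<open>metis lessThan_iff less_irrefl\<close>)
  moreover have "pick T ` {..<card T} \<subseteq> T"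
    using pick_in_set_le by auto
  moreover have "card (pick T ` {..<card T}) = card T"
    using inj by (simp add: card_image)
  ultimately show ?thesis
    using assms by (simp add: bij_betw_def card_subset_eq)
qed

lemma det_submatrix_eq_pdet:
  assumes "M \<in> carrier_mat n n" "T \<subseteq> {..<n}"
  shows "det (submatrix M T T) = pdet T (\<lambda>i j. M $$ (i, j))"
proof -
  have "{i. i < n \<and> i \<in> T} = T" using assms by auto
  then have "submatrix M T T = mat (card T) (card T) (\<lambda>(i, j). M $$ (pick T i, pick T j))"
    using assms by (simp add: submatrix_def)
  moreover have "finite T" using assms(2) finite_subset by blast
  ultimately show ?thesis
    using pdet_eq_det[OF bij_betw_pick[of T], of "\<lambda>i j. M $$ (i, j)"] by simp
qed

text \<open>A determinant is affine in each diagonal entry, with the complementary principal minor as slope: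
  the terms containing the entry at \<open>k\<close> come from the permutations fixing \<open>k\<close>.\<close>

lemma pdet_add_diag_one:
  assumes "finite S" "k \<in> S"
  shows "pdet S (add_diag a (x(k := x k + c))) = pdet S (add_diag a x) + c * pdet (S - {k}) (add_diag a x)"
proof -
  let ?P = "{\<pi>. \<pi> permutes S}"
  let ?Q = "{\<pi>. \<pi> permutes (S - {k})}"
  let ?m = "add_diag a x" and ?m' = "add_diag a (x(k := x k + c))"
  have fin: "finite ?P" using assms finite_permutations by blast
  have QP: "?Q \<subseteq> ?P" using permutes_subset by blast
  have Q: "\<pi> k = k" if "\<pi> \<in> ?Q" for \<pi>
    using that by (auto simp: permutes_def)
  have PQ: "\<pi> k \<noteq> k" if "\<pi> \<in> ?P - ?Q" for \<pi>
    using that by (auto simp: permutes_def)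
  have rest: "(\<Prod>i\<in>S - {k}. ?m' i (\<pi> i)) = (\<Prod>i\<in>S - {k}. ?m i (\<pi> i))" for \<pi>
    by (rule prod.cong) (auto simp: add_diag_def)
  have split: "(\<Prod>i\<in>S. m i (\<pi> i)) = m k (\<pi> k) * (\<Prod>i\<in>S - {k}. m i (\<pi> i))" for m \<pi>
    using assms by (simp add: prod.remove)
  have "pdet S ?m' = (\<Sum>\<pi>\<in>?P. signof \<pi> * (\<Prod>i\<in>S. ?m i (\<pi> i)) +
      (if \<pi> \<in> ?Q then c * (signof \<pi> * (\<Prod>i\<in>S - {k}. ?m i (\<pi> i))) else 0))"
    unfolding pdet_def
  proof (rule sum.cong[OF refl])
    fix \<pi> assume p: "\<pi> \<in> ?P"
    show "signof \<pi> * (\<Prod>i\<in>S. ?m' i (\<pi> i)) = signof \<pi> * (\<Prod>i\<in>S. ?m i (\<pi> i)) +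
      (if \<pi> \<in> ?Q then c * (signof \<pi> * (\<Prod>i\<in>S - {k}. ?m i (\<pi> i))) else 0)"
    proof (cases "\<pi> \<in> ?Q")
      case True
      then show ?thesis
        unfolding split rest using Q[OF True] by (simp add: add_diag_def algebra_simps)
    next
      case False
      then have "\<pi> k \<noteq> k" using PQ p by blast
      then show ?thesis
        unfolding split rest using False by (simp add: add_diag_def)
    qed
  qed
  also have "\<dots> = pdet S ?m + c * pdet (S - {k}) ?m"
    using QP fin Int_absorb1[OF QP]
    by (simp only: sum.distrib sum.If_cases[OF fin] pdet_def sum_distrib_left mem_Collect_eq Collect_mem_eq) (simp add: Collect_conj_eq[symmetric] sum_distrib_left)
  finally show ?thesis .
qed

lemma pdet_add_diag_outside:
  assumes "\<And>i. i \<in> S \<Longrightarrow> x i = y i"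
  shows "pdet S (add_diag a x) = pdet S (add_diag a y)"
  by (rule pdet_cong) (use assms in \<open>auto simp: add_diag_def\<close>)

text \<open>The coefficients of \<open>det (diag x + a)\<close> are the principal minors of \<open>a\<close>.\<close>

lemma pdet_add_diag_expansion:
  assumes "finite S"
  shows "pdet S (add_diag a x) = (\<Sum>U\<in>Pow S. (\<Prod>k\<in>U. x k) * pdet (S - U) a)"
proof -
  (* Switching on the variables of a growing set V one at a time makes an induction possible while the
     index set R of the determinant stays arbitrary. *)
  have "pdet R (add_diag a (\<lambda>i. if i \<in> V then x i else 0)) =
      (\<Sum>U\<in>Pow V. (\<Prod>k\<in>U. x k) * pdet (R - U) a)"
    if "finite V" "V \<subseteq> R" "finite R" for V R
    using that
  proof (induction V arbitrary: R rule: finite_induct)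
    case empty
    then show ?case by (auto intro!: pdet_cong simp: add_diag_def)
  next
    case (insert k V)
    let ?y = "\<lambda>i. if i \<in> V then x i else 0"
    have "(\<lambda>i. if i \<in> insert k V then x i else 0) = ?y(k := ?y k + x k)"
      using insert.hyps by (auto simp: fun_eq_iff)
    then have "pdet R (add_diag a (\<lambda>i. if i \<in> insert k V then x i else 0))
       = pdet R (add_diag a ?y) + x k * pdet (R - {k}) (add_diag a ?y)"
      using insert.prems pdet_add_diag_one[of R k a ?y "x k"] by simp
    also have "pdet R (add_diag a ?y) = (\<Sum>U\<in>Pow V. (\<Prod>k\<in>U. x k) * pdet (R - U) a)"
      by (rule insert.IH) (use insert.prems in auto)
    also have "pdet (R - {k}) (add_diag a ?y) = (\<Sum>U\<in>Pow V. (\<Prod>k\<in>U. x k) * pdet (R - {k} - U) a)"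
      by (rule insert.IH) (use insert.prems insert.hyps in auto)
    also have "x k * \<dots> = (\<Sum>U\<in>insert k ` Pow V. (\<Prod>k\<in>U. x k) * pdet (R - U) a)"
    proof -
      have inj: "inj_on (insert k) (Pow V)"
        using insert.hyps by (auto simp: inj_on_def)
      have "(\<Prod>i\<in>insert k U. x i) = x k * (\<Prod>i\<in>U. x i)" if "U \<in> Pow V" for U
      proof -
        have "finite U" "k \<notin> U" using that insert.hyps finite_subset by auto
        then show ?thesis by simp
      qed
      then show ?thesis
        unfolding sum.reindex[OF inj] sum_distrib_left o_def
        by (intro sum.cong refl) (simp add: Diff_insert2[of R k, symmetric] mult.assoc)
    qed
    also have "(\<Sum>U\<in>Pow V. (\<Prod>k\<in>U. x k) * pdet (R - U) a) +
         (\<Sum>U\<in>insert k ` Pow V. (\<Prod>k\<in>U. x k) * pdet (R - U) a)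
       = (\<Sum>U\<in>Pow (insert k V). (\<Prod>k\<in>U. x k) * pdet (R - U) a)"
      unfolding Pow_insert by (rule sum.union_disjoint[symmetric]) (use insert.hyps in auto)
    finally show ?case .
  qed
  from this[of S S] assms show ?thesis
    using pdet_add_diag_outside[of S "\<lambda>i. if i \<in> S then x i else 0" x a] by simp
qed

text \<open>An enumeration of \<open>S\<close> that lists \<open>T\<close> first, through which facts about block matrices carry over
  to \<open>pdet\<close>.\<close>

lemma ex_bij_split:
  assumes "finite (S :: nat set)" "T \<subseteq> S"
  obtains h where "bij_betw h {..<card T} T" "bij_betw (\<lambda>i. h (card T + i)) {..<card (S - T)} (S - T)"
    "bij_betw h {..<card T + card (S - T)} S"
proof -
  have fin: "finite T" "finite (S - T)" using assms finite_subset by auto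
  define h where "h i = (if i < card T then pick T i else pick (S - T) (i - card T))" for i
  have 1: "bij_betw h {..<card T} T"
    using bij_betw_pick[OF fin(1)] by (rule bij_betw_cong[THEN iffD1, rotated]) (simp add: h_def)
  have 2: "bij_betw (\<lambda>i. h (card T + i)) {..<card (S - T)} (S - T)"
    using bij_betw_pick[OF fin(2)] by (simp add: h_def)
  have "bij_betw (\<lambda>i. card T + i) {..<card (S - T)} {card T..<card T + card (S - T)}"
    by (rule bij_betwI[where g="\<lambda>i. i - card T"]) auto
  then have "bij_betw h {card T..<card T + card (S - T)} (S - T)"
    using bij_betw_comp_iff[of "\<lambda>i. card T + i" "{..<card (S - T)}" "{card T..<card T + card (S - T)}" h "S - T"] 2
    by (simp add: o_def)
  with 1 have "bij_betw h ({..<card T} \<union> {card T..<card T + card (S - T)}) (T \<union> (S - T))"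
    by (rule bij_betw_combine) auto
  moreover have "{..<card T} \<union> {card T..<card T + card (S - T)} = {..<card T + card (S - T)}" by auto
  moreover have "T \<union> (S - T) = S" using assms by auto
  ultimately have 3: "bij_betw h {..<card T + card (S - T)} S" by simp
  from that[OF 1 2 3] show ?thesis .
qed

lemma pdet_block_triangular:
  fixes m :: "nat \<Rightarrow> nat \<Rightarrow> 'a :: idom"
  assumes "finite S" "T \<subseteq> S" "\<And>i j. i \<in> T \<Longrightarrow> j \<in> S - T \<Longrightarrow> m i j = 0"
  shows "pdet S m = pdet T m * pdet (S - T) m"
proof -
  obtain h where h1: "bij_betw h {..<card T} T"
    and h2: "bij_betw (\<lambda>i. h (card T + i)) {..<card (S - T)} (S - T)"
    and h3: "bij_betw h {..<card T + card (S - T)} S"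
    using ex_bij_split assms(1,2) by blast
  let ?c = "card T" and ?d = "card (S - T)"
  let ?f = "\<lambda>(i, j). m (h i) (h j)"
  have in1: "h i \<in> T" if "i < ?c" for i using h1 that by (auto simp: bij_betw_def)
  have in2: "h (?c + i) \<in> S - T" if "i < ?d" for i using h2 that by (auto simp: bij_betw_def)
  have "mat (?c + ?d) (?c + ?d) ?f = four_block_mat (mat ?c ?c ?f) (0\<^sub>m ?c ?d)
     (mat ?d ?c (\<lambda>(i, j). m (h (?c + i)) (h j))) (mat ?d ?d (\<lambda>(i, j). m (h (?c + i)) (h (?c + j))))"
  proof (rule eq_matI, goal_cases)
    case (1 i j)
    then have "m (h i) (h j) = 0" if "i < ?c" "\<not> j < ?c"
      using assms(3)[OF in1[of i] in2[of "j - ?c"]] that by simp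
    with 1 show ?case by auto
  qed auto
  then show ?thesis
    unfolding pdet_eq_det[OF h3] pdet_eq_det[OF h1] pdet_eq_det[OF h2]
    by (simp add: det_four_block_mat_upper_right_zero[of _ ?c _ ?d])
qed

lemma pdet_singleton [simp]: "pdet {k} m = m k k"
  by (simp add: pdet_def)

text \<open>Elimination of the index \<open>k\<close>: multiplying from the left by a unipotent matrix clears the column of \<open>k\<close>.\<close>

lemma pdet_schur:
  fixes m :: "nat \<Rightarrow> nat \<Rightarrow> 'a :: field"
  assumes "finite S" "k \<notin> S" "m k k \<noteq> 0"
  shows "pdet (insert k S) m = m k k * pdet S (\<lambda>i j. m i j - m i k * m k j / m k k)"
proof -
  have fin: "finite (insert k S)" "S \<subseteq> insert k S" using assms by auto
  obtain h where h1: "bij_betw h {..<card S} S"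
    and h2: "bij_betw (\<lambda>i. h (card S + i)) {..<card (insert k S - S)} (insert k S - S)"
    and h3: "bij_betw h {..<card S + card (insert k S - S)} (insert k S)"
    using ex_bij_split[OF fin] by blast
  have kS: "insert k S - S = {k}" using assms by auto
  let ?n = "card S"
  have hn: "h ?n = k" using h2 by (auto simp: kS bij_betw_def)
  have h3': "bij_betw h {..<Suc ?n} (insert k S)" using h3 by (simp add: kS)
  let ?f = "\<lambda>(i, j). m (h i) (h j)"
  let ?M' = "mat ?n ?n (\<lambda>(i, j). m (h i) (h j) - m (h i) k * m k (h j) / m k k)"
  (* L adds to each row the multiple of the last row that clears its last entry. *)
  let ?L = "four_block_mat (1\<^sub>m ?n) (mat ?n 1 (\<lambda>(i, j). - m (h i) k / m k k)) (0\<^sub>m 1 ?n) (1\<^sub>m 1)"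
  let ?M = "four_block_mat (mat ?n ?n ?f) (mat ?n 1 (\<lambda>(i, j). m (h i) k))
     (mat 1 ?n (\<lambda>(i, j). m k (h j))) (mat 1 1 (\<lambda>_. m k k))"
  have M: "mat (Suc ?n) (Suc ?n) ?f = ?M"
    by (rule eq_matI) (auto simp: less_Suc_eq hn)
  have "?L * ?M = four_block_mat ?M' (0\<^sub>m ?n 1) (mat 1 ?n (\<lambda>(i, j). m k (h j))) (mat 1 1 (\<lambda>_. m k k))"
    by (subst mult_four_block_mat[of _ ?n ?n _ 1 _ 1 _ _ ?n _ 1])
      (auto intro!: cong_four_block_mat eq_matI simp: scalar_prod_def assms(3) diff_divide_distrib)
  then have "det (?L * ?M) = det ?M' * m k k"
    by (simp add: det_four_block_mat_upper_right_zero[of _ ?n _ 1] det_single)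
  moreover have "det (?L * ?M) = det ?L * det ?M"
    by (rule det_mult[of _ "?n + 1"]) (auto intro!: four_block_carrier_mat)
  moreover have "det ?L = 1"
    by (simp add: det_four_block_mat_lower_left_zero[of _ ?n _ 1])
  ultimately have "det ?M = m k k * det ?M'" by (simp only: mult_1_left mult.commute)
  then show ?thesis
    unfolding pdet_eq_det[OF h3'] pdet_eq_det[OF h1] M .
qed

text \<open>Each Leibniz term is unchanged under conjugation by \<open>diag d\<close>, since the factors \<open>d\<close> cancel
  along every permutation.\<close>

lemma pdet_scale:
  fixes m :: "nat \<Rightarrow> nat \<Rightarrow> 'a :: field"
  assumes "finite S" "\<And>i. i \<in> S \<Longrightarrow> d i \<noteq> 0"
  shows "pdet S (\<lambda>i j. m i j * d j / d i) = pdet S m"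
  unfolding pdet_def
proof (rule sum.cong[OF refl], clarify)
  fix \<pi> assume p: "\<pi> permutes S"
  have "(\<Prod>i\<in>S. d (\<pi> i)) = (\<Prod>i\<in>S. d i)"
    using prod.permute[OF p, of d] by (simp add: o_def)
  moreover have "(\<Prod>i\<in>S. d i) \<noteq> 0" using assms by simp
  ultimately show "signof \<pi> * (\<Prod>i\<in>S. m i (\<pi> i) * d (\<pi> i) / d i) = signof \<pi> * (\<Prod>i\<in>S. m i (\<pi> i))"
    by (simp add: prod_dividef prod.distrib)
qed

lemma pdet_pair:
  assumes "i \<noteq> j"
  shows "pdet {i, j} m = m i i * m j j - m i j * m j i"
proof -
  have P: "{\<pi>. \<pi> permutes {i, j}} = {id, transpose i j}"
    using permutes_doubleton_iff[of _ i j] by auto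
  have "id \<noteq> transpose i j" using assms by (metis id_apply transpose_apply_first)
  then show ?thesis
    using assms by (simp add: pdet_def P sign_swap_id algebra_simps)
qed


section \<open>The Rayleigh inequality\<close>

lemma add_diag_zero [simp]: "add_diag a (\<lambda>i. 0) = a"
  by (simp add: add_diag_def fun_eq_iff)

text \<open>A determinant at a real point. Taking the real part makes it a real number; it loses
  nothing when the principal minors are real.\<close>

definition real_det :: "(nat \<Rightarrow> nat \<Rightarrow> complex) \<Rightarrow> nat set \<Rightarrow> (nat \<Rightarrow> real) \<Rightarrow> real" where
  "real_det a T x = Re (pdet T (add_diag a (\<lambda>i. complex_of_real (x i))))"

text \<open>The property of real stable determinants that is used: the principal minors are real, and
  \<open>\<partial>\<^sub>i f \<partial>\<^sub>j f - f \<partial>\<^sub>i \<partial>\<^sub>j f \<ge> 0\<close> at real points. Partial derivatives of \<open>f = det (diag x + a)\<close> are determinants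
  over smaller index sets.\<close>

definition rayleigh :: "nat set \<Rightarrow> (nat \<Rightarrow> nat \<Rightarrow> complex) \<Rightarrow> bool" where
  "rayleigh S a \<longleftrightarrow> (\<forall>T\<subseteq>S. pdet T a \<in> \<real>) \<and>
     (\<forall>x. \<forall>i\<in>S. \<forall>j\<in>S. i \<noteq> j \<longrightarrow>
        real_det a S x * real_det a (S - {i, j}) x \<le> real_det a (S - {i}) x * real_det a (S - {j}) x)"

lemma rayleigh_minor_real: "rayleigh S a \<Longrightarrow> T \<subseteq> S \<Longrightarrow> pdet T a \<in> \<real>"
  by (simp add: rayleigh_def)

lemma rayleigh_inequality:
  "rayleigh S a \<Longrightarrow> i \<in> S \<Longrightarrow> j \<in> S \<Longrightarrow> i \<noteq> j \<Longrightarrow>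
     real_det a S x * real_det a (S - {i, j}) x \<le> real_det a (S - {i}) x * real_det a (S - {j}) x"
  by (simp add: rayleigh_def)

lemma pdet_add_diag_real:
  assumes "finite T" "\<And>U. U \<subseteq> T \<Longrightarrow> pdet U a \<in> \<real>"
  shows "pdet T (add_diag a (\<lambda>i. complex_of_real (x i))) = complex_of_real (real_det a T x)"
proof -
  have "pdet T (add_diag a (\<lambda>i. complex_of_real (x i))) \<in> \<real>"
    unfolding pdet_add_diag_expansion[OF assms(1)]
    by (intro sum_in_Reals Reals_mult prod_in_Reals) (auto intro: assms(2))
  then show ?thesis by (simp add: real_det_def)
qed

lemma real_det_update:
  assumes "finite T" "k \<in> T"
  shows "real_det a T (x(k := t)) = real_det a T (x(k := 0)) + t * real_det a (T - {k}) x"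
proof -
  let ?y = "\<lambda>i. complex_of_real ((x(k := 0)) i)"
  have eq: "(\<lambda>i. complex_of_real ((x(k := t)) i)) = ?y(k := ?y k + complex_of_real t)"
    by (auto simp: fun_eq_iff)
  have "pdet (T - {k}) (add_diag a ?y) = pdet (T - {k}) (add_diag a (\<lambda>i. complex_of_real (x i)))"
    by (rule pdet_add_diag_outside) auto
  then have "pdet T (add_diag a (?y(k := ?y k + complex_of_real t))) =
      pdet T (add_diag a ?y) + complex_of_real t * pdet (T - {k}) (add_diag a (\<lambda>i. complex_of_real (x i)))"
    using pdet_add_diag_one[OF assms, of a ?y] by (simp only:)
  then show ?thesis
    unfolding real_det_def eq by (simp only: plus_complex.sel) simp
qed

lemma real_det_cong:
  assumes "\<And>i. i \<in> T \<Longrightarrow> x i = y i"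
  shows "real_det a T x = real_det a T y"
  unfolding real_det_def by (subst pdet_add_diag_outside[of T _ "\<lambda>i. complex_of_real (y i)"]) (use assms in auto)

text \<open>A negative leading coefficient would win for large arguments.\<close>

lemma quadratic_nonneg_lead:
  fixes A B C :: real
  assumes "\<And>t. 0 \<le> A * t\<^sup>2 + B * t + C"
  shows "0 \<le> A"
proof (rule ccontr)
  assume "\<not> 0 \<le> A"
  then have A: "A < 0" by simp
  (* This t is at least 1 and makes A * t + B at most - \<bar>C\<bar> - 1. *)
  define t where "t = (\<bar>B\<bar> + \<bar>C\<bar> + 1) / (- A) + 1"
  have "0 \<le> (\<bar>B\<bar> + \<bar>C\<bar> + 1) / (- A)" using A by (intro divide_nonneg_pos) auto
  then have t: "t \<ge> 1" by (simp only: t_def)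
  have "- A * t = \<bar>B\<bar> + \<bar>C\<bar> + 1 - A" using A by (simp add: t_def field_simps)
  then have "A * t + B \<le> - \<bar>C\<bar> - 1" using A by linarith
  then have "t * (A * t + B) \<le> t * (- \<bar>C\<bar> - 1)" using t by (intro mult_left_mono) auto
  also have "\<dots> \<le> 1 * (- \<bar>C\<bar> - 1)" using t by (intro mult_right_mono_neg) auto
  finally have "A * t\<^sup>2 + B * t + C < 0" by (simp add: power2_eq_square algebra_simps)
  with assms[of t] show False by simp
qed

text \<open>The two sides of the inequality are quadratic polynomials in \<open>x\<^sub>k\<close> whose leading coefficients are
  the two sides of the inequality without the index \<open>k\<close>.\<close>

lemma rayleigh_delete:
  assumes "finite S" "rayleigh S a" "k \<in> S"
  shows "rayleigh (S - {k}) a"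
  unfolding rayleigh_def
proof (intro conjI allI ballI impI)
  show "pdet T a \<in> \<real>" if "T \<subseteq> S - {k}" for T
    using rayleigh_minor_real[OF assms(2)] that by blast
next
  fix x :: "nat \<Rightarrow> real" and i j assume i: "i \<in> S - {k}" and j: "j \<in> S - {k}" and ij: "i \<noteq> j"
  let ?x0 = "x(k := 0)"
  let ?A = "real_det a (S - {i} - {k}) x * real_det a (S - {j} - {k}) x - real_det a (S - {k}) x * real_det a (S - {i, j} - {k}) x"
  have "0 \<le> ?A * t\<^sup>2 +
     (real_det a (S - {i}) ?x0 * real_det a (S - {j} - {k}) x + real_det a (S - {i} - {k}) x * real_det a (S - {j}) ?x0
       - real_det a S ?x0 * real_det a (S - {i, j} - {k}) x - real_det a (S - {k}) x * real_det a (S - {i, j}) ?x0) * t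
     + (real_det a (S - {i}) ?x0 * real_det a (S - {j}) ?x0 - real_det a S ?x0 * real_det a (S - {i, j}) ?x0)" for t
  proof -
    have u: "real_det a T (x(k := t)) = real_det a T ?x0 + t * real_det a (T - {k}) x"
      if "T \<in> {S, S - {i}, S - {j}, S - {i, j}}" for T
      by (rule real_det_update) (use assms i j that in auto)
    have "real_det a S (x(k := t)) * real_det a (S - {i, j}) (x(k := t)) \<le>
       real_det a (S - {i}) (x(k := t)) * real_det a (S - {j}) (x(k := t))"
      using i j ij by (intro rayleigh_inequality[OF assms(2)]) auto
    then show ?thesis by (simp add: u algebra_simps power2_eq_square)
  qed
  then have "0 \<le> ?A" by (rule quadratic_nonneg_lead)
  moreover have "S - {i} - {k} = S - {k} - {i}" "S - {j} - {k} = S - {k} - {j}"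
    "S - {i, j} - {k} = S - {k} - {i, j}" by auto
  ultimately show "real_det a (S - {k}) x * real_det a (S - {k} - {i, j}) x
      \<le> real_det a (S - {k} - {i}) x * real_det a (S - {k} - {j}) x"
    by simp
qed

lemma rayleigh_subset:
  assumes "finite S" "rayleigh S a" "T \<subseteq> S"
  shows "rayleigh T a"
proof -
  have "finite (S - T)" using assms by auto
  then have "rayleigh (S - (S - T)) a"
  proof (induction "S - T" arbitrary: T rule: finite_psubset_induct)
    case psubset
    show ?case
    proof (cases "S - T = {}")
      case True
      then show ?thesis using assms(2) by (metis Diff_empty)
    next
      case False
      then obtain k where k: "k \<in> S - T" by blast
      have "rayleigh (S - (S - insert k T)) a"
        by (rule psubset.hyps(2)) (use k in auto)
      moreover have "S - (S - T) = (S - (S - insert k T)) - {k}" using k by auto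
      ultimately show ?thesis
        using rayleigh_delete[of "S - (S - insert k T)" a k] k assms(1) by auto
    qed
  qed
  moreover have "S - (S - T) = T" using assms(3) by auto
  ultimately show ?thesis by simp
qed

lemma rayleigh_diag_real:
  assumes "rayleigh S a" "i \<in> S"
  shows "a i i \<in> \<real>"
proof -
  have "pdet {i} a \<in> \<real>" by (rule rayleigh_minor_real[OF assms(1)]) (use assms(2) in simp)
  then show ?thesis by simp
qed

text \<open>This is the inequality for the index set \<open>{i, j}\<close> at the origin.\<close>

lemma rayleigh_offdiag:
  assumes "finite S" "rayleigh S a" "i \<in> S" "j \<in> S" "i \<noteq> j"
  shows "a i j * a j i \<in> \<real>" "0 \<le> Re (a i j * a j i)"
proof -
  have r: "a i i \<in> \<real>" "a j j \<in> \<real>" using rayleigh_diag_real[OF assms(2)] assms(3,4) by auto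
  have P: "pdet {i, j} a \<in> \<real>"
    by (rule rayleigh_minor_real[OF assms(2)]) (use assms in simp)
  have "a i i * a j j - pdet {i, j} a \<in> \<real>"
    by (intro Reals_diff Reals_mult r P)
  then show real: "a i j * a j i \<in> \<real>" by (simp add: pdet_pair[OF assms(5)])
  have "rayleigh {i, j} a"
    by (rule rayleigh_subset[OF assms(1,2)]) (use assms in auto)
  then have "real_det a {i, j} (\<lambda>_. 0) * real_det a ({i, j} - {i, j}) (\<lambda>_. 0)
     \<le> real_det a ({i, j} - {i}) (\<lambda>_. 0) * real_det a ({i, j} - {j}) (\<lambda>_. 0)"
    using assms(5) by (intro rayleigh_inequality) auto
  moreover have "{i, j} - {i, j} = {}" "{i, j} - {i} = {j}" "{i, j} - {j} = {i}"
    using assms(5) by auto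
  ultimately have "Re (a i i * a j j - a i j * a j i) \<le> Re (a j j) * Re (a i i)"
    using assms(5) by (simp add: real_det_def pdet_pair add_diag_def)
  moreover have "Re (a i i * a j j) = Re (a i i) * Re (a j j)"
    using r by (simp add: complex_is_Real_iff)
  ultimately show "0 \<le> Re (a i j * a j i)"
    by (simp only: minus_complex.sel mult.commute[of "Re (a j j)"])
qed

text \<open>Fixing \<open>x\<^sub>k = t\<close> in every determinant over a set containing \<open>k\<close> gives \<open>a\<^sub>k\<^sub>k + t\<close> times the corresponding
  determinant of the Schur complement. This real factor occurs squared on both sides of the
  inequality.\<close>

lemma rayleigh_schur:
  assumes "finite S" "rayleigh S a" "k \<in> S" "a k k + complex_of_real t \<noteq> 0"
  defines "b \<equiv> \<lambda>i j. a i j - a i k * a k j / (a k k + complex_of_real t)"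
  shows "rayleigh (S - {k}) b"
proof -
  let ?c = "a k k + complex_of_real t"
  have schur: "pdet (insert k T) (add_diag a (\<lambda>i. complex_of_real ((x(k := t)) i)))
      = ?c * pdet T (add_diag b (\<lambda>i. complex_of_real (x i)))"
    if "T \<subseteq> S - {k}" for T x
  proof -
    let ?m = "add_diag a (\<lambda>i. complex_of_real ((x(k := t)) i))"
    have "finite T" "k \<notin> T" "?m k k \<noteq> 0"
      using that assms(1,4) finite_subset by (auto simp: add_diag_def)
    then have "pdet (insert k T) ?m = ?m k k * pdet T (\<lambda>i j. ?m i j - ?m i k * ?m k j / ?m k k)"
      by (rule pdet_schur)
    also have "pdet T (\<lambda>i j. ?m i j - ?m i k * ?m k j / ?m k k) = pdet T (add_diag b (\<lambda>i. complex_of_real (x i)))"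
      by (rule pdet_cong) (use that in \<open>auto simp: add_diag_def b_def\<close>)
    also have "?m k k = ?c" by (simp add: add_diag_def)
    finally show ?thesis .
  qed
  have c: "?c \<in> \<real>" using rayleigh_diag_real[OF assms(2,3)] by simp
  have pr: "pdet T a \<in> \<real>" if "T \<subseteq> S" for T
    using rayleigh_minor_real[OF assms(2)] that .
  have rb: "pdet T b \<in> \<real>" if T: "T \<subseteq> S - {k}" for T
  proof -
    have "finite (insert k T)" "insert k T \<subseteq> S" using T assms finite_subset by auto
    then have "pdet (insert k T) (add_diag a (\<lambda>i. complex_of_real (((\<lambda>_. 0)(k := t)) i))) \<in> \<real>"
      by (subst pdet_add_diag_real) (auto intro: pr)
    then have "?c * pdet T (add_diag b (\<lambda>i. 0)) \<in> \<real>"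
      unfolding schur[OF T] by simp
    then have "?c * pdet T b / ?c \<in> \<real>"
      using c by (intro Reals_divide) simp_all
    then show ?thesis using assms(4) by simp
  qed
  have real_det: "real_det a (insert k T) (x(k := t)) = Re ?c * real_det b T x" if "T \<subseteq> S - {k}" for T x
    unfolding real_det_def schur[OF that] using c by (simp add: complex_is_Real_iff)
  show ?thesis
    unfolding rayleigh_def
  proof (intro conjI allI ballI impI)
    show "pdet T b \<in> \<real>" if "T \<subseteq> S - {k}" for T using rb that .
    fix x :: "nat \<Rightarrow> real" and i j assume i: "i \<in> S - {k}" and j: "j \<in> S - {k}" and ij: "i \<noteq> j"
    have ins: "insert k (S - {k}) = S" "insert k (S - {k} - {i, j}) = S - {i, j}"
      "insert k (S - {k} - {i}) = S - {i}" "insert k (S - {k} - {j}) = S - {j}"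
      using assms(3) i j by auto
    have "real_det a S (x(k := t)) * real_det a (S - {i, j}) (x(k := t)) \<le>
       real_det a (S - {i}) (x(k := t)) * real_det a (S - {j}) (x(k := t))"
      using i j ij by (intro rayleigh_inequality[OF assms(2)]) auto
    then have "(Re ?c)\<^sup>2 * (real_det b (S - {k}) x * real_det b (S - {k} - {i, j}) x)
      \<le> (Re ?c)\<^sup>2 * (real_det b (S - {k} - {i}) x * real_det b (S - {k} - {j}) x)"
      using real_det[of "S - {k}" x] real_det[of "S - {k} - {i, j}" x] real_det[of "S - {k} - {i}" x] real_det[of "S - {k} - {j}" x]
      unfolding ins by (simp add: power2_eq_square Diff_subset mult.assoc mult.left_commute)
    moreover have "Re ?c \<noteq> 0" using c assms(4) by (metis complex_is_Real_iff complex_eqI zero_complex.sel)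
    ultimately show "real_det b (S - {k}) x * real_det b (S - {k} - {i, j}) x
      \<le> real_det b (S - {k} - {i}) x * real_det b (S - {k} - {j}) x"
      by simp
  qed
qed

section \<open>Strong connectivity and Hermitian weights\<close>

text \<open>Strong connectivity of the digraph with an edge \<open>i \<rightarrow> j\<close> whenever \<open>a i j \<noteq> 0\<close>, in the form that no
  proper nonempty set of vertices is closed under outgoing edges.\<close>

definition strongly_connected :: "nat set \<Rightarrow> (nat \<Rightarrow> nat \<Rightarrow> complex) \<Rightarrow> bool" where
  "strongly_connected S a \<longleftrightarrow> (\<forall>T. T \<subset> S \<longrightarrow> T \<noteq> {} \<longrightarrow> (\<exists>i\<in>T. \<exists>j\<in>S - T. a i j \<noteq> 0))"

lemma strongly_connectedE:
  assumes "strongly_connected S a" "T \<subset> S" "T \<noteq> {}"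
  obtains i j where "i \<in> T" "j \<in> S - T" "a i j \<noteq> 0"
proof -
  have "\<exists>i\<in>T. \<exists>j\<in>S - T. a i j \<noteq> 0"
    using assms(1)[unfolded strongly_connected_def, rule_format, OF assms(2,3)] .
  then obtain i where "i \<in> T" "\<exists>j\<in>S - T. a i j \<noteq> 0" by (rule bexE)
  then show thesis by (auto intro: that)
qed

text \<open>The weights \<open>p\<close> are the squares of the entries of a real diagonal matrix that conjugates \<open>a\<close> to a
  Hermitian matrix.\<close>

definition hermitizable :: "nat set \<Rightarrow> (nat \<Rightarrow> nat \<Rightarrow> complex) \<Rightarrow> bool" where
  "hermitizable S a \<longleftrightarrow> (\<exists>p :: nat \<Rightarrow> real. (\<forall>i\<in>S. 0 < p i) \<and>
     (\<forall>i\<in>S. \<forall>j\<in>S. a i j * complex_of_real (p j) = complex_of_real (p i) * cnj (a j i)))"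

text \<open>Contracting the vertex \<open>k\<close> of a strongly connected digraph: a path \<open>i \<rightarrow> k \<rightarrow> j\<close> becomes an edge.\<close>

lemma strongly_connected_schur:
  assumes "strongly_connected S a" "k \<in> S"
    and "\<And>i j. i \<in> S - {k} \<Longrightarrow> j \<in> S - {k} \<Longrightarrow> i \<noteq> j \<Longrightarrow> a i j \<noteq> 0 \<or> a i k * a k j \<noteq> 0 \<Longrightarrow> b i j \<noteq> 0"
  shows "strongly_connected (S - {k}) b"
  unfolding strongly_connected_def
proof (intro allI impI)
  fix T assume T: "T \<subset> S - {k}" "T \<noteq> {}"
  have "T \<subset> S" "insert k T \<subset> S" using T assms(2) by auto
  then obtain i j i' j' where 1: "i \<in> T" "j \<in> S - T" "a i j \<noteq> 0"
    and 2: "i' \<in> insert k T" "j' \<in> S - insert k T" "a i' j' \<noteq> 0"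
    using assms(1) T(2) unfolding strongly_connected_def by (metis insert_not_empty)
  (* An edge leaving T and an edge leaving T with k added: unless one of them avoids k, they compose
     to a path through k. *)
  consider "j \<noteq> k" | "i' \<noteq> k" | "j = k" "i' = k" by blast
  then show "\<exists>i\<in>T. \<exists>j\<in>S - {k} - T. b i j \<noteq> 0"
  proof cases
    case 1
    have "b i j \<noteq> 0"
      by (rule assms(3)) (use 1 \<open>i \<in> T\<close> \<open>j \<in> S - T\<close> \<open>a i j \<noteq> 0\<close> T in auto)
    then show ?thesis using 1 \<open>i \<in> T\<close> \<open>j \<in> S - T\<close> by blast
  next
    case h: 2
    have "b i' j' \<noteq> 0"
      by (rule assms(3)) (use h 2 T in auto)
    then show ?thesis using h 2 by blast
  next
    case h: 3
    have "b i j' \<noteq> 0"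
      by (rule assms(3)) (use h 1 2 T in auto)
    then show ?thesis using h 1 2 by blast
  qed
qed

text \<open>Up to sign, the coefficients of the real quadratic are \<open>\<alpha> + \<beta>\<close> and \<open>\<alpha> \<beta>\<close>, so \<open>\<alpha>\<close> and \<open>\<beta>\<close> are either conjugate or both
  real; in the second case distinct values would make the quadratic change sign.\<close>

lemma nonneg_pencil_normalized:
  fixes \<alpha> \<beta> :: complex
  assumes real: "\<And>r :: real. (1 - r * \<alpha>) * (1 - r * \<beta>) \<in> \<real>"
    and nonneg: "\<And>r :: real. 0 \<le> Re ((1 - r * \<alpha>) * (1 - r * \<beta>))"
  shows "\<beta> = cnj \<alpha>"
proof -
  have im: "Im ((1 - r * \<alpha>) * (1 - r * \<beta>)) = 0" for r :: real
    using real complex_is_Real_iff by blast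
  have e1: "r * (r * Im (\<alpha> * \<beta>) - Im (\<alpha> + \<beta>)) = 0" for r :: real
    using im[of r] by (simp add: algebra_simps)
  have s: "Im \<alpha> + Im \<beta> = 0" and q: "Im (\<alpha> * \<beta>) = 0"
    using e1[of 1] e1[of 2] by auto
  have "Im \<beta> = - Im \<alpha>" using s by linarith
  have "Im \<alpha> * (Re \<beta> - Re \<alpha>) = 0"
    using q by (simp add: \<open>Im \<beta> = - Im \<alpha>\<close> algebra_simps)
  then consider "Re \<beta> = Re \<alpha>" | "Im \<alpha> = 0" by auto
  then show ?thesis
  proof cases
    case 1
    then show ?thesis using s by (simp add: complex_eq_iff)
  next
    case 2
    then have im0: "Im \<alpha> = 0" "Im \<beta> = 0" using s by auto
    let ?a = "Re \<alpha>" and ?b = "Re \<beta>"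
    have n: "0 \<le> (1 - r * ?a) * (1 - r * ?b)" for r :: real
      using nonneg[of r] im0 by simp
    have "?a = ?b"
    proof (cases "?a + ?b = 0")
      case True
      then have b: "?b = - ?a" by simp
      have "?a = 0"
      proof (rule ccontr)
        assume "?a \<noteq> 0"
        (* The polynomial is 1 - r^2 a^2, which takes the value -3 here. *)
        with n[of "2 / ?a"] show False by (simp add: b)
      qed
      then show ?thesis using b by simp
    next
      case False
      (* At this point the two real factors are opposite to each other. *)
      let ?r = "2 / (?a + ?b)"
      have "(1 - ?r * ?a) * (1 - ?r * ?b) = - ((?a - ?b) / (?a + ?b))\<^sup>2"
        using False by (simp add: divide_simps power2_eq_square) (simp add: algebra_simps)
      with n[of ?r] have "((?a - ?b) / (?a + ?b))\<^sup>2 \<le> 0" by simp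
      then show ?thesis using False by simp
    qed
    then show ?thesis using im0 by (simp add: complex_eq_iff)
  qed
qed

text \<open>Two nonzero linear polynomials in \<open>s\<close> whose product is nonnegative on the real line are conjugate up to a
  positive factor, and this factor can be read off at any point where they do not vanish. Recentring at \<open>s\<^sub>0\<close>
  and dividing by the values there reduces this to constant terms 1.\<close>

lemma nonneg_pencil:
  fixes u v u' v' :: complex and s\<^sub>0 \<rho> :: real
  assumes real: "\<And>s :: real. (u - s * v) * (u' - s * v') \<in> \<real>"
    and nonneg: "\<And>s :: real. 0 \<le> Re ((u - s * v) * (u' - s * v'))"
    and ratio: "u' - s\<^sub>0 * v' = \<rho> * cnj (u - s\<^sub>0 * v)" and "0 < \<rho>" and w: "u - s\<^sub>0 * v \<noteq> 0"
  shows "u' = \<rho> * cnj u \<and> v' = \<rho> * cnj v"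
proof -
  define w where "w = u - s\<^sub>0 * v"
  define \<alpha> where "\<alpha> = v / w"
  define \<beta> where "\<beta> = v' / (\<rho> * cnj w)"
  have w0: "w \<noteq> 0" using w by (simp add: w_def)
  have v: "v = w * \<alpha>" "v' = \<rho> * cnj w * \<beta>" using w0 \<open>0 < \<rho>\<close> by (simp_all add: \<alpha>_def \<beta>_def)
  have u: "u = w + s\<^sub>0 * v" "u' = \<rho> * cnj w + s\<^sub>0 * v'"
    using ratio by (simp_all add: w_def algebra_simps)
  define c where "c = \<rho> * (cmod w)\<^sup>2"
  have c: "0 < c" using w0 \<open>0 < \<rho>\<close> by (simp add: c_def)
  have eq: "(u - (s\<^sub>0 + r) * v) * (u' - (s\<^sub>0 + r) * v') = c * ((1 - r * \<alpha>) * (1 - r * \<beta>))" for r :: real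
  proof -
    have "(u - (s\<^sub>0 + r) * v) * (u' - (s\<^sub>0 + r) * v') = (w - r * v) * (\<rho> * cnj w - r * v')"
      unfolding u by (simp add: algebra_simps)
    also have "\<dots> = \<rho> * (w * cnj w) * ((1 - r * \<alpha>) * (1 - r * \<beta>))"
      unfolding v by (simp add: algebra_simps)
    also have "\<rho> * (w * cnj w) = complex_of_real c"
      unfolding c_def of_real_mult complex_norm_square ..
    finally show ?thesis .
  qed
  have "\<beta> = cnj \<alpha>"
  proof (rule nonneg_pencil_normalized)
    fix r :: real
    define z where "z = (1 - r * \<alpha>) * (1 - r * \<beta>)"
    have R: "c * z \<in> \<real>" and N: "0 \<le> Re (c * z)"
      using real[of "s\<^sub>0 + r"] nonneg[of "s\<^sub>0 + r"] unfolding eq z_def by this+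
    have "c * z / c \<in> \<real>" using R by (intro Reals_divide) simp_all
    then show "(1 - r * \<alpha>) * (1 - r * \<beta>) \<in> \<real>" using c by (simp add: z_def)
    show "0 \<le> Re ((1 - r * \<alpha>) * (1 - r * \<beta>))"
      unfolding z_def[symmetric] using N c by (simp add: zero_le_mult_iff)
  qed
  then have v': "v' = \<rho> * cnj v" using v by simp
  then show ?thesis using u by (simp add: algebra_simps)
qed


lemma hermitizable_singleton:
  assumes "a k k \<in> \<real>"
  shows "hermitizable {k} a"
  unfolding hermitizable_def using assms by (intro exI[of _ "\<lambda>_. 1"]) (auto simp: Reals_cnj_iff)

text \<open>Each of the finitely many nonzero linear polynomials excludes at most one real \<open>s\<close>.\<close>

lemma ex_real_avoiding_roots:
  fixes a b :: "'i \<Rightarrow> complex"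
  assumes "finite I"
  obtains s :: real where "s \<noteq> 0" "\<And>i. i \<in> I \<Longrightarrow> a i \<noteq> 0 \<or> b i \<noteq> 0 \<Longrightarrow> a i - s * b i \<noteq> 0"
proof -
  define bad where "bad = insert 0 ((\<lambda>i. Re (a i / b i)) ` I)"
  have "finite bad" using assms by (simp add: bad_def)
  then obtain s where s: "s \<notin> bad" using ex_new_if_finite infinite_UNIV_char_0 by metis
  show ?thesis
  proof (rule that[of s])
    show "s \<noteq> 0" using s by (auto simp: bad_def)
    fix i assume i: "i \<in> I" "a i \<noteq> 0 \<or> b i \<noteq> 0"
    show "a i - s * b i \<noteq> 0"
    proof
      assume eq: "a i - s * b i = 0"
      then have "b i \<noteq> 0" using i(2) by auto
      then have "a i / b i = s" using eq by (simp add: field_simps)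
      then have "s = Re (a i / b i)" by simp
      then show False using s i(1) by (auto simp: bad_def)
    qed
  qed
qed

text \<open>The relation \<open>two\<close> says that the ratios \<open>a i k / (p i * cnj (a k i))\<close> do not depend on \<open>i\<close>. Their common
  inverse, computed at a single out-neighbour \<open>j\<^sub>0\<close> of \<open>k\<close>, is the weight of \<open>k\<close>; it is positive because
  \<open>a j\<^sub>0 k * a k j\<^sub>0\<close> is.\<close>

lemma hermitizable_extend:
  fixes a :: "nat \<Rightarrow> nat \<Rightarrow> complex" and p :: "nat \<Rightarrow> real"
  assumes p: "\<And>i. i \<in> S \<Longrightarrow> 0 < p i" and k: "k \<notin> S" "a k k \<in> \<real>"
    and sym: "\<And>i j. i \<in> S \<Longrightarrow> j \<in> S \<Longrightarrow> a i j * p j = p i * cnj (a j i)"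
    and two: "\<And>i j. i \<in> S \<Longrightarrow> j \<in> S \<Longrightarrow> a i k * a k j * p j = p i * cnj (a j k * a k i)"
    and nonneg: "\<And>i. i \<in> S \<Longrightarrow> a i k * a k i \<in> \<real> \<and> 0 \<le> Re (a i k * a k i)"
    and in_out: "i\<^sub>0 \<in> S" "a i\<^sub>0 k \<noteq> 0" "j\<^sub>0 \<in> S" "a k j\<^sub>0 \<noteq> 0"
  shows "hermitizable (insert k S) a"
proof -
  have "a i\<^sub>0 k * a k j\<^sub>0 * p j\<^sub>0 \<noteq> 0" using in_out p[of j\<^sub>0] by simp
  then have nz: "a j\<^sub>0 k \<noteq> 0" "p j\<^sub>0 \<noteq> 0"
    using two[of i\<^sub>0 j\<^sub>0] in_out by auto
  define r where "r = Re (a j\<^sub>0 k * a k j\<^sub>0)"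
  have r: "a j\<^sub>0 k * a k j\<^sub>0 = r" unfolding r_def by (rule of_real_Re[symmetric]) (use nonneg[OF in_out(3)] in blast)
  have "r \<noteq> 0" using r nz in_out by auto
  then have "0 < r" using nonneg[of j\<^sub>0] in_out by (simp add: r_def)
  (* The weight of k: it has to satisfy q * cnj (a j0 k) = a k j0 * p j0. *)
  define q where "q = r * p j\<^sub>0 / (cmod (a j\<^sub>0 k))\<^sup>2"
  have q: "0 < q" using \<open>0 < r\<close> nz p[of j\<^sub>0] in_out by (simp add: q_def)
  have qeq: "q * cnj (a j\<^sub>0 k) = a k j\<^sub>0 * p j\<^sub>0"
  proof -
    have "complex_of_real q = a j\<^sub>0 k * a k j\<^sub>0 * p j\<^sub>0 / (a j\<^sub>0 k * cnj (a j\<^sub>0 k))"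
      by (simp only: q_def of_real_divide of_real_mult complex_norm_square r)
    then show ?thesis using nz by simp
  qed
  have col: "a i k * q = p i * cnj (a k i)" if "i \<in> S" for i
  proof -
    have "cnj (a j\<^sub>0 k) * (a i k * q) = a i k * a k j\<^sub>0 * p j\<^sub>0"
      using qeq by (simp add: algebra_simps)
    also have "\<dots> = cnj (a j\<^sub>0 k) * (p i * cnj (a k i))"
      using two[OF that in_out(3)] by (simp add: algebra_simps)
    finally show ?thesis using nz by simp
  qed
  have row: "a k i * p i = q * cnj (a i k)" if "i \<in> S" for i
    using arg_cong[OF col[OF that], of cnj] by (simp add: mult.commute)
  have kk: "a k k = cnj (a k k)" using k(2) Reals_cnj_iff by metis
  show ?thesis
    unfolding hermitizable_def
  proof (intro exI[of _ "p(k := q)"] conjI ballI)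
    show "0 < (p(k := q)) i" if "i \<in> insert k S" for i using that p q by auto
    fix i j assume "i \<in> insert k S" "j \<in> insert k S"
    then show "a i j * (p(k := q)) j = (p(k := q)) i * cnj (a j i)"
      using k(1) sym row col kk by (cases "i = k"; cases "j = k") (auto simp: mult.commute)
  qed
qed

text \<open>Induction by eliminating one index \<open>k\<close>. Every real \<open>s \<noteq> 0\<close> has the form \<open>1 / (a k k + t)\<close> with \<open>t\<close> real, so
  \<open>b s\<close> is a Schur complement; \<open>b 0\<close> is \<open>a\<close> itself. The weights of one generic \<open>b s\<^sub>0\<close> turn out to work
  for the coefficients of \<open>b s\<close> separately.\<close>

theorem rayleigh_imp_hermitizable:
  assumes "finite S" "rayleigh S a" "strongly_connected S a"
  shows "hermitizable S a"
  using assms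
proof (induction "card S" arbitrary: S a rule: less_induct)
  case less
  note fin = less.prems(1) and ray = less.prems(2) and conn = less.prems(3)
  consider "S = {}" | k where "S = {k}" | k where "k \<in> S" "S - {k} \<noteq> {}"
    by blast
  then show ?case
  proof cases
    case 1
    then show ?thesis by (simp add: hermitizable_def)
  next
    case (2 k)
    then show ?thesis using hermitizable_singleton rayleigh_diag_real[OF ray] by simp
  next
    case (3 k)
    let ?S = "S - {k}"
    define b where "b s i j = a i j - complex_of_real s * (a i k * a k j)" for s i j
    have ray_b: "rayleigh ?S (b s)" for s
    proof (cases "s = 0")
      case True
      then have "b s = a" by (simp add: b_def fun_eq_iff)
      then show ?thesis using rayleigh_delete[OF fin ray 3(1)] by simp
    next
      case False
      define t where "t = 1 / s - Re (a k k)"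
      have "a k k = Re (a k k)" using rayleigh_diag_real[OF ray 3(1)] by simp
      then have t: "a k k + complex_of_real t = 1 / s"
        by (simp add: t_def of_real_diff of_real_divide)
      then have "b s = (\<lambda>i j. a i j - a i k * a k j / (a k k + complex_of_real t))"
        by (simp add: b_def fun_eq_iff mult.commute)
      then show ?thesis
        using rayleigh_schur[OF fin ray 3(1), of t] False t by simp
    qed
    obtain s\<^sub>0 :: real where "s\<^sub>0 \<noteq> 0"
      and good: "\<And>i j. i \<in> S \<Longrightarrow> j \<in> S \<Longrightarrow> a i j \<noteq> 0 \<or> a i k * a k j \<noteq> 0 \<Longrightarrow> b s\<^sub>0 i j \<noteq> 0"
    proof (rule ex_real_avoiding_roots[of "S \<times> S" "\<lambda>(i, j). a i j" "\<lambda>(i, j). a i k * a k j"], goal_cases)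
      case 1
      then show ?case using fin by simp
    next
      case (2 s)
      show ?case
      proof (rule 2(1))
        show "s \<noteq> 0" by fact
        show "b s i j \<noteq> 0" if "i \<in> S" "j \<in> S" "a i j \<noteq> 0 \<or> a i k * a k j \<noteq> 0" for i j
          using 2(3)[of "(i, j)"] that by (simp add: b_def)
      qed
    qed
    have "strongly_connected ?S (b s\<^sub>0)"
      by (rule strongly_connected_schur[OF conn 3(1)]) (use good in auto)
    moreover have "card ?S < card S" using fin 3(1) by (rule card_Diff1_less)
    ultimately have "hermitizable ?S (b s\<^sub>0)"
      using less.hyps[of ?S "b s\<^sub>0"] fin ray_b by simp
    then obtain p :: "nat \<Rightarrow> real" where p: "\<And>i. i \<in> ?S \<Longrightarrow> 0 < p i"
      and sym: "\<And>i j. i \<in> ?S \<Longrightarrow> j \<in> ?S \<Longrightarrow> b s\<^sub>0 i j * p j = p i * cnj (b s\<^sub>0 j i)"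
      unfolding hermitizable_def by blast
    have nonneg: "a i k * a k i \<in> \<real> \<and> 0 \<le> Re (a i k * a k i)" if "i \<in> ?S" for i
      using rayleigh_offdiag[OF fin ray, of i k] that 3(1) by auto
    (* The products b s i j * b s j i are nonnegative for all real s, and at s0 the ratio of the two
       factors is known. *)
    have split: "a i j * p j = p i * cnj (a j i) \<and> a i k * a k j * p j = p i * cnj (a j k * a k i)"
      if ij: "i \<in> ?S" "j \<in> ?S" "i \<noteq> j" for i j
    proof (cases "b s\<^sub>0 i j = 0")
      case True
      then have "b s\<^sub>0 j i = 0" using sym[OF ij(1,2)] p[OF ij(1)] by auto
      with True have z: "a i j = 0" "a j i = 0" "a i k * a k j = 0" "a j k * a k i = 0"
        using good[of i j] good[of j i] ij by blast+
      show ?thesis unfolding z by simp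
    next
      case False
      have pos: "0 < p j / p i" using p ij by simp
      have "b s\<^sub>0 j i * p i = p j * cnj (b s\<^sub>0 i j)" using sym[OF ij(2,1)] .
      then have ratio: "b s\<^sub>0 j i = complex_of_real (p j / p i) * cnj (b s\<^sub>0 i j)"
        using p[OF ij(1)] by (simp add: field_simps)
      have "a j i = complex_of_real (p j / p i) * cnj (a i j) \<and>
          a j k * a k i = complex_of_real (p j / p i) * cnj (a i k * a k j)"
      proof (rule nonneg_pencil[where s\<^sub>0 = s\<^sub>0])
        show "(a i j - complex_of_real s * (a i k * a k j)) * (a j i - complex_of_real s * (a j k * a k i)) \<in> \<real>" for s
          using rayleigh_offdiag(1)[OF _ ray_b[of s] ij] fin by (simp add: b_def)
        show "0 \<le> Re ((a i j - complex_of_real s * (a i k * a k j)) * (a j i - complex_of_real s * (a j k * a k i)))" for s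
          using rayleigh_offdiag(2)[OF _ ray_b[of s] ij] fin unfolding b_def by simp
        show "a j i - complex_of_real s\<^sub>0 * (a j k * a k i)
            = complex_of_real (p j / p i) * cnj (a i j - complex_of_real s\<^sub>0 * (a i k * a k j))"
          using ratio unfolding b_def .
        show "a i j - complex_of_real s\<^sub>0 * (a i k * a k j) \<noteq> 0" using False unfolding b_def .
      qed (fact pos)
      then have c: "cnj (a j i) = complex_of_real (p j / p i) * a i j"
        "cnj (a j k * a k i) = complex_of_real (p j / p i) * (a i k * a k j)"
        by (simp_all only: complex_cnj_mult complex_cnj_complex_of_real complex_cnj_cnj)
      show ?thesis unfolding c using p[OF ij(1)] by simp
    qed
    obtain i\<^sub>0 where i0: "i\<^sub>0 \<in> ?S" "a i\<^sub>0 k \<noteq> 0"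
    proof -
      have "?S \<subset> S" using 3(1) by auto
      then obtain i j where "i \<in> ?S" "j \<in> S - ?S" "a i j \<noteq> 0"
        using strongly_connectedE[OF conn _ 3(2)] by metis
      then show thesis using that by auto
    qed
    obtain j\<^sub>0 where j0: "j\<^sub>0 \<in> ?S" "a k j\<^sub>0 \<noteq> 0"
    proof -
      have "{k} \<subset> S" using 3 by auto
      then obtain i j where "i \<in> {k}" "j \<in> S - {k}" "a i j \<noteq> 0"
        using strongly_connectedE[OF conn, of "{k}"] by (metis insert_not_empty)
      then show thesis using that by auto
    qed
    have "hermitizable (insert k ?S) a"
    proof (rule hermitizable_extend[of ?S p k a i\<^sub>0 j\<^sub>0])
      show "a k k \<in> \<real>" using rayleigh_diag_real[OF ray 3(1)] .
      fix i j assume i: "i \<in> ?S" and j: "j \<in> ?S"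
      show "a i j * p j = p i * cnj (a j i)"
      proof (cases "i = j")
        case True
        have "a i i \<in> \<real>" using rayleigh_diag_real[OF ray] i by simp
        then show ?thesis using True by (metis Reals_cnj_iff mult.commute)
      next
        case False
        then show ?thesis using split i j by blast
      qed
      show "a i k * a k j * p j = p i * cnj (a j k * a k i)"
      proof (cases "i = j")
        case True
        have "cnj (a i k * a k i) = a i k * a k i" using nonneg[OF i] Reals_cnj_iff by blast
        then show ?thesis using True by (metis mult.commute)
      next
        case False
        then show ?thesis using split i j by blast
      qed
    qed (use p nonneg i0 j0 in auto)
    moreover have "insert k ?S = S" using 3(1) by auto
    ultimately show ?thesis by simp
  qed
qed


section \<open>Coefficients of determinantal polynomials\<close>

abbreviation entry :: "complex mat \<Rightarrow> nat \<Rightarrow> nat \<Rightarrow> complex" where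
  "entry A i j \<equiv> A $$ (i, j)"

definition monom_of :: "nat set \<Rightarrow> nat \<Rightarrow>\<^sub>0 nat" where
  "monom_of U = (\<Sum>k\<in>U. Poly_Mapping.single k 1)"

lemma lookup_monom_of:
  assumes "finite U"
  shows "Poly_Mapping.lookup (monom_of U) k = (if k \<in> U then 1 else 0)"
  using assms by (simp add: monom_of_def lookup_sum lookup_single when_def sum.delta)

lemma keys_monom_of:
  assumes "finite U"
  shows "Poly_Mapping.keys (monom_of U) = U"
  using assms by (auto simp: in_keys_iff lookup_monom_of split: if_splits)

lemma inj_on_monom_of: "inj_on monom_of {U. finite U}"
  by (rule inj_onI) (metis keys_monom_of mem_Collect_eq)

lemma monom_of_eq_iff:
  "finite U \<Longrightarrow> finite V \<Longrightarrow> monom_of U = monom_of V \<longleftrightarrow> U = V"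
  by (metis keys_monom_of)

lemma monom_of_Un:
  assumes "finite U" "finite V" "U \<inter> V = {}"
  shows "monom_of U + monom_of V = monom_of (U \<union> V)"
  using assms by (simp add: monom_of_def sum.union_disjoint)

lemma monom_degree_monom_of: "finite U \<Longrightarrow> monom_degree (monom_of U) = card U"
  by (simp add: monom_degree_def keys_monom_of lookup_monom_of)

lemma monom_of_keys:
  assumes "\<And>k. Poly_Mapping.lookup m k \<le> 1"
  shows "m = monom_of (Poly_Mapping.keys m)"
proof (rule poly_mapping_eqI)
  fix k
  show "Poly_Mapping.lookup m k = Poly_Mapping.lookup (monom_of (Poly_Mapping.keys m)) k"
    using assms[of k] by (auto simp: lookup_monom_of in_keys_iff)
qed

lemma prod_X: "finite U \<Longrightarrow> (\<Prod>k\<in>U. X k) = Poly_Mapping.single (monom_of U) 1"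
proof (induction U rule: finite_induct)
  case empty
  then show ?case by (simp add: monom_of_def)
next
  case (insert k U)
  then show ?case by (simp add: X_def mult_single monom_of_def)
qed

lemma Const_add: "Const (a + b) = Const a + Const b"
  by (simp add: Const_def single_add)
lemma Const_mult: "Const (a * b) = Const a * Const b"
  by (simp add: Const_def mult_single)
lemma Const_zero: "Const 0 = 0" by (simp add: Const_def)
lemma Const_one: "Const 1 = 1" by (simp add: Const_def)
lemma Const_uminus: "Const (- a) = - Const a"
  by (simp add: Const_def single_uminus)

lemma Const_pdet: "Const (pdet S a) = pdet S (\<lambda>i j. Const (a i j))"
proof -
  have sum: "Const (sum g I) = (\<Sum>i\<in>I. Const (g i))" for g :: "(nat \<Rightarrow> nat) \<Rightarrow> complex" and I
    by (induction I rule: infinite_finite_induct) (simp_all add: Const_zero Const_add)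
  have prod: "Const (prod g I) = (\<Prod>i\<in>I. Const (g i))" for g :: "nat \<Rightarrow> complex" and I
    by (induction I rule: infinite_finite_induct) (simp_all add: Const_one Const_mult)
  have sign: "Const (signof \<pi>) = signof \<pi>" for \<pi> :: "nat \<Rightarrow> nat"
    by (simp add: sign_def Const_one Const_uminus)
  show ?thesis by (simp add: pdet_def sum prod sign Const_mult)
qed

lemma det_poly_eq_pdet:
  assumes "A \<in> carrier_mat n n" "T \<subseteq> {..<n}"
  shows "det_poly A T = pdet T (add_diag (\<lambda>i j. Const (entry A i j)) X)"
proof -
  have "diag_plus A \<in> carrier_mat n n"
    using assms by (simp add: diag_plus_def)
  then have "det_poly A T = pdet T (\<lambda>i j. diag_plus A $$ (i, j))"
    unfolding det_poly_def using assms(2) by (rule det_submatrix_eq_pdet)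
  also have "\<dots> = pdet T (add_diag (\<lambda>i j. Const (entry A i j)) X)"
  proof (rule pdet_cong)
    fix i j assume "i \<in> T" "j \<in> T"
    then have "i < n" "j < n" using assms(2) by auto
    then show "diag_plus A $$ (i, j) = add_diag (\<lambda>i j. Const (entry A i j)) X i j"
      using assms(1) by (simp add: diag_plus_def mat_diag_def add_diag_def)
  qed
  finally show ?thesis .
qed

lemma det_diag_plus:
  assumes "A \<in> carrier_mat n n"
  shows "det (diag_plus A) = det_poly A {..<n}"
proof -
  have c: "diag_plus A \<in> carrier_mat n n"
    using assms by (simp add: diag_plus_def)
  then show ?thesis
    unfolding det_poly_def by (simp add: det_submatrix_eq_pdet[OF c] det_eq_pdet[OF c])
qed

lemma det_poly_expansion:
  assumes "A \<in> carrier_mat n n" "T \<subseteq> {..<n}"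
  shows "det_poly A T = (\<Sum>U\<in>Pow T. Poly_Mapping.single (monom_of U) (pdet (T - U) (entry A)))"
proof -
  have fin: "finite T" using assms(2) finite_subset by blast
  show ?thesis
    unfolding det_poly_eq_pdet[OF assms] pdet_add_diag_expansion[OF fin]
  proof (rule sum.cong[OF refl])
    fix U assume "U \<in> Pow T"
    then have "finite U" using fin finite_subset by auto
    then show "prod X U * pdet (T - U) (\<lambda>i j. Const (entry A i j))
        = Poly_Mapping.single (monom_of U) (pdet (T - U) (entry A))"
      unfolding Const_pdet[symmetric] prod_X[OF \<open>finite U\<close>] by (simp add: Const_def mult_single)
  qed
qed

lemma lookup_det_poly:
  assumes "A \<in> carrier_mat n n" "T \<subseteq> {..<n}" "U \<subseteq> T"
  shows "Poly_Mapping.lookup (det_poly A T) (monom_of U) = pdet (T - U) (entry A)"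
proof -
  have fin: "finite T" using assms(2) finite_subset by blast
  have "Poly_Mapping.lookup (det_poly A T) (monom_of U)
      = (\<Sum>U'\<in>Pow T. if U' = U then pdet (T - U') (entry A) else 0)"
    unfolding det_poly_expansion[OF assms(1,2)] lookup_sum
  proof (rule sum.cong[OF refl])
    fix U' assume "U' \<in> Pow T"
    then have "finite U'" "finite U" using fin assms(3) finite_subset by auto
    then show "Poly_Mapping.lookup (Poly_Mapping.single (monom_of U') (pdet (T - U') (entry A))) (monom_of U)
       = (if U' = U then pdet (T - U') (entry A) else 0)"
      by (simp add: lookup_single when_def monom_of_eq_iff)
  qed
  then show ?thesis using assms(3) fin by (simp add: sum.delta)
qed

lemma keys_det_poly:
  assumes "A \<in> carrier_mat n n" "T \<subseteq> {..<n}"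
  shows "Poly_Mapping.keys (det_poly A T) \<subseteq> monom_of ` Pow T"
proof -
  have "Poly_Mapping.keys (det_poly A T) \<subseteq>
      (\<Union>U\<in>Pow T. Poly_Mapping.keys (Poly_Mapping.single (monom_of U) (pdet (T - U) (entry A))))"
    unfolding det_poly_expansion[OF assms] by (rule keys_sum)
  also have "\<dots> \<subseteq> monom_of ` Pow T" by (auto split: if_splits)
  finally show ?thesis .
qed

lemma det_poly_in_mpolys:
  assumes "A \<in> carrier_mat n n" "T \<subseteq> {..<n}"
  shows "det_poly A T \<in> mpolys n"
  unfolding mpolys_def
proof (intro CollectI ballI)
  fix m assume "m \<in> Poly_Mapping.keys (det_poly A T)"
  then obtain U where U: "U \<subseteq> T" "m = monom_of U" using keys_det_poly[OF assms] by auto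
  then have "finite U" using assms(2) by (meson finite_lessThan finite_subset)
  then show "Poly_Mapping.keys m \<subseteq> {..<n}" using U assms(2) by (simp add: keys_monom_of)
qed

text \<open>Both sides are sums over the squarefree monomials with principal minors as coefficients.\<close>

lemma eval_det_poly:
  assumes "A \<in> carrier_mat n n"
  shows "eval_mpoly z (det_poly A {..<n}) = pdet {..<n} (add_diag (entry A) z)"
proof -
  let ?f = "det_poly A {..<n}"
  let ?t = "\<lambda>m. Poly_Mapping.lookup ?f m * (\<Prod>k\<in>Poly_Mapping.keys m. z k ^ Poly_Mapping.lookup m k)"
  have inj: "inj_on monom_of (Pow {..<n})"
    by (rule inj_on_subset[OF inj_on_monom_of]) (auto intro: finite_subset)
  have "eval_mpoly z ?f = (\<Sum>m\<in>monom_of ` Pow {..<n}. ?t m)"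
    unfolding eval_mpoly_def
  proof (rule sum.mono_neutral_left)
    show "Poly_Mapping.keys ?f \<subseteq> monom_of ` Pow {..<n}"
      by (rule keys_det_poly[OF assms]) simp
  qed (auto simp: in_keys_iff)
  also have "\<dots> = (\<Sum>U\<in>Pow {..<n}. (\<Prod>k\<in>U. z k) * pdet ({..<n} - U) (entry A))"
    unfolding sum.reindex[OF inj] o_def
  proof (rule sum.cong[OF refl])
    fix U assume U: "U \<in> Pow {..<n}"
    then have "finite U" using finite_subset by auto
    then show "?t (monom_of U) = (\<Prod>k\<in>U. z k) * pdet ({..<n} - U) (entry A)"
      using U lookup_det_poly[OF assms subset_refl, of U]
      by (simp add: keys_monom_of lookup_monom_of)
  qed
  finally show ?thesis by (simp add: pdet_add_diag_expansion)
qed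

section \<open>From real stability to the Rayleigh inequality\<close>

lemma tendsto_pdet_add_diag:
  assumes "\<And>k. ((\<lambda>e. y e k) \<longlongrightarrow> y' k) F"
  shows "((\<lambda>e. pdet S (add_diag a (y e))) \<longlongrightarrow> pdet S (add_diag a y' :: nat \<Rightarrow> nat \<Rightarrow> complex)) F"
  unfolding pdet_def add_diag_def
  by (intro tendsto_sum tendsto_mult tendsto_prod tendsto_const tendsto_add)
    (auto intro: assms)

text \<open>As a polynomial in \<open>z = x\<^sub>i\<close> and \<open>w = x\<^sub>j\<close>, with the other variables real, the determinant is
  \<open>\<alpha> + z \<beta> + w \<gamma> + z w \<delta>\<close> with real coefficients, and the inequality reads \<open>\<alpha> \<delta> \<le> \<beta> \<gamma>\<close>. If it fails,
  the zero \<open>z = - (\<alpha> + w \<gamma>) / (\<beta> + w \<delta>)\<close> at \<open>w = \<i>\<close> has positive imaginary part. It still does after the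
  other variables are moved to \<open>x\<^sub>k + e \<i>\<close> with a small \<open>e > 0\<close>, by continuity, and then all variables lie in the
  open upper half plane.\<close>

lemma stable_imp_rayleigh_inequality:
  fixes a :: "nat \<Rightarrow> nat \<Rightarrow> complex"
  assumes fin: "finite S"
    and real: "\<And>T. T \<subseteq> S \<Longrightarrow> pdet T a \<in> \<real>"
    and stable: "\<And>z. (\<And>k. k \<in> S \<Longrightarrow> 0 < Im (z k)) \<Longrightarrow> pdet S (add_diag a z) \<noteq> 0"
    and i: "i \<in> S" and j: "j \<in> S" and ij: "i \<noteq> j"
  shows "real_det a S x * real_det a (S - {i, j}) x \<le> real_det a (S - {i}) x * real_det a (S - {j}) x"
proof (rule ccontr)
  assume neg: "\<not> ?thesis"
  define y where "y e k = (if k = i \<or> k = j then 0 else complex_of_real (x k) + complex_of_real e * \<i>)"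
    for e :: real and k
  (* C S, C (S - {i}), C (S - {j}) and C (S - {i, j}) are the coefficients alpha, beta, gamma and delta
     at the displaced point, and R gives their values for e = 0. *)
  define C where "C T e = pdet T (add_diag a (y e))" for T e
  define R where "R T = real_det a T (x(i := 0, j := 0))" for T
  have two: "pdet S (add_diag a ((y e)(i := z, j := w))) =
      C S e + z * C (S - {i}) e + w * (C (S - {j}) e + z * C (S - {i, j}) e)" for e z w
  proof -
    have 1: "pdet T (add_diag a ((y e)(i := z))) = C T e + z * C (T - {i}) e" if "finite T" "i \<in> T" for T
      using pdet_add_diag_one[OF that, of a "y e" z] by (simp add: C_def y_def)
    have "pdet S (add_diag a ((y e)(i := z, j := w)))
        = pdet S (add_diag a ((y e)(i := z))) + w * pdet (S - {j}) (add_diag a ((y e)(i := z)))"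
      using pdet_add_diag_one[OF fin j, of a "(y e)(i := z)" w] ij by (simp add: y_def)
    then show ?thesis
      using 1[of S] 1[of "S - {j}"] fin i ij by (simp add: Diff_insert2[symmetric] insert_commute)
  qed
  have C0: "C T 0 = complex_of_real (R T)" if "T \<subseteq> S" for T
  proof -
    have "y 0 = (\<lambda>k. complex_of_real ((x(i := 0, j := 0)) k))" by (auto simp: y_def)
    moreover have "finite T" using that fin finite_subset by blast
    ultimately show ?thesis
      unfolding C_def R_def using pdet_add_diag_real[of T a] real that by (metis subset_trans)
  qed
  have upd: "real_det a T x = real_det a T (x(k := 0)) + x k * real_det a (T - {k}) x" if "finite T" "k \<in> T" for T k x
    using real_det_update[OF that, of a x "x k"] by simp
  have drop: "real_det a T x = real_det a T (x(k := 0))" if "k \<notin> T" for T k x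
    by (rule real_det_cong) (use that in auto)
  (* The inequality at x is equivalent to the inequality between the coefficients, that is, to the one
     at the point where the i-th and j-th coordinates vanish. *)
  have e_ij: "real_det a (S - {i, j}) x = R (S - {i, j})"
    unfolding R_def by (rule real_det_cong) auto
  have e_i: "real_det a (S - {i}) x = R (S - {i}) + x j * R (S - {i, j})"
    using upd[of "S - {i}" j "x(i := 0)"] drop[of i "S - {i}" x] drop[of i "S - {i, j}" x] e_ij fin j ij
    by (simp add: R_def Diff_insert2[symmetric] insert_commute)
  have e_j: "real_det a (S - {j}) x = R (S - {j}) + x i * R (S - {i, j})"
    using upd[of "S - {j}" i "x(j := 0)"] drop[of j "S - {j}" x] drop[of j "S - {i, j}" x] e_ij fin i ij
    by (simp add: R_def Diff_insert2[symmetric] insert_commute fun_upd_twist)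
  have e_S: "real_det a S x = R S + x i * R (S - {i}) + x j * real_det a (S - {j}) x"
    using upd[OF fin j, of x] upd[OF fin i, of "x(j := 0)"] drop[of i "S - {i}" "x(j := 0)"] ij
    by (simp add: R_def fun_upd_twist)
  have det: "R (S - {i}) * R (S - {j}) < R S * R (S - {i, j})"
    using neg unfolding e_S e_i e_j e_ij by (simp add: algebra_simps)
  define z where "z e = - (C S e + \<i> * C (S - {j}) e) / (C (S - {i}) e + \<i> * C (S - {i, j}) e)" for e
  have den0: "C (S - {i}) 0 + \<i> * C (S - {i, j}) 0 \<noteq> 0"
  proof
    assume "C (S - {i}) 0 + \<i> * C (S - {i, j}) 0 = 0"
    then have "R (S - {i}) = 0" "R (S - {i, j}) = 0"
      by (auto simp: C0 Diff_subset complex_eq_iff)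
    then show False using det by simp
  qed
  have Im0: "0 < Im (z 0)"
  proof -
    have "Im (z 0) = (R S * R (S - {i, j}) - R (S - {i}) * R (S - {j})) / ((R (S - {i}))\<^sup>2 + (R (S - {i, j}))\<^sup>2)"
      by (simp add: z_def C0 Diff_subset Im_divide algebra_simps diff_divide_distrib add_divide_distrib)
    moreover have "0 < (R (S - {i}))\<^sup>2 + (R (S - {i, j}))\<^sup>2"
      using det by (auto simp: sum_power2_gt_zero_iff)
    ultimately show ?thesis using det by simp
  qed
  have limC: "((\<lambda>e. C T e) \<longlongrightarrow> C T 0) (at_right 0)" for T
  proof -
    have "((\<lambda>e. y e k) \<longlongrightarrow> y 0 k) (at_right 0)" for k
      unfolding y_def by (cases "k = i \<or> k = j") (auto intro!: tendsto_eq_intros)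
    then show ?thesis unfolding C_def by (rule tendsto_pdet_add_diag)
  qed
  have limz: "(z \<longlongrightarrow> z 0) (at_right 0)"
    unfolding z_def by (intro tendsto_intros limC den0)
  have "\<forall>\<^sub>F e in at_right 0. 0 < Im (z e)"
    by (rule order_tendstoD(1)[OF tendsto_Im[OF limz] Im0])
  moreover have "\<forall>\<^sub>F e in at_right 0. C (S - {i}) e + \<i> * C (S - {i, j}) e \<noteq> 0"
  proof -
    have "((\<lambda>e. C (S - {i}) e + \<i> * C (S - {i, j}) e) \<longlongrightarrow> C (S - {i}) 0 + \<i> * C (S - {i, j}) 0) (at_right 0)"
      by (intro tendsto_intros limC)
    then show ?thesis using den0 by (rule tendsto_imp_eventually_ne)
  qed
  moreover have "\<forall>\<^sub>F e in at_right (0 :: real). 0 < e"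
    by (rule eventually_at_right_less)
  ultimately have "\<forall>\<^sub>F e in at_right 0. 0 < Im (z e) \<and> C (S - {i}) e + \<i> * C (S - {i, j}) e \<noteq> 0 \<and> 0 < e"
    by eventually_elim simp
  then obtain e where e: "0 < Im (z e)" "C (S - {i}) e + \<i> * C (S - {i, j}) e \<noteq> 0" "0 < e"
    using eventually_happens'[of "at_right (0 :: real)"] by auto
  have "pdet S (add_diag a ((y e)(i := z e, j := \<i>))) =
      (C S e + \<i> * C (S - {j}) e) + z e * (C (S - {i}) e + \<i> * C (S - {i, j}) e)"
    unfolding two by (simp add: algebra_simps)
  also have "\<dots> = 0" using e(2) by (simp add: z_def)
  finally show False
    using stable[of "(y e)(i := z e, j := \<i>)"] e by (auto simp: y_def)
qed

lemma real_stable_imp_rayleigh: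
  assumes "A \<in> carrier_mat n n" "real_stable n (det (diag_plus A))"
  shows "rayleigh {..<n} (entry A)"
proof -
  let ?f = "det_poly A {..<n}"
  have st: "real_stable n ?f" using assms(2) by (simp add: det_diag_plus[OF assms(1)])
  have real: "pdet T (entry A) \<in> \<real>" if "T \<subseteq> {..<n}" for T
  proof -
    have "Poly_Mapping.lookup ?f (monom_of ({..<n} - T)) \<in> \<real>" using st by (simp add: real_stable_def)
    moreover have "{..<n} - ({..<n} - T) = T" using that by auto
    ultimately show ?thesis by (simp add: lookup_det_poly[OF assms(1) subset_refl])
  qed
  moreover have "pdet {..<n} (add_diag (entry A) z) \<noteq> 0" if "\<And>k. k \<in> {..<n} \<Longrightarrow> 0 < Im (z k)" for z
    using st that unfolding real_stable_def eval_det_poly[OF assms(1)] by auto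
  ultimately show ?thesis
    unfolding rayleigh_def by (simp add: stable_imp_rayleigh_inequality)
qed


section \<open>Factors of a multiaffine polynomial\<close>

definition degx :: "nat \<Rightarrow> mpoly \<Rightarrow> nat" where
  "degx k p = Max (insert 0 ((\<lambda>m. Poly_Mapping.lookup m k) ` Poly_Mapping.keys p))"

lemma degx_ge: "m \<in> Poly_Mapping.keys p \<Longrightarrow> Poly_Mapping.lookup m k \<le> degx k p"
  unfolding degx_def by (rule Max_ge) auto

lemma degx_le: "(\<And>m. m \<in> Poly_Mapping.keys p \<Longrightarrow> Poly_Mapping.lookup m k \<le> d) \<Longrightarrow> degx k p \<le> d"
  unfolding degx_def by (subst Max_le_iff) auto

lemma degx_attained:
  assumes "p \<noteq> 0"
  obtains m where "m \<in> Poly_Mapping.keys p" "Poly_Mapping.lookup m k = degx k p"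
proof -
  have "degx k p \<in> insert 0 ((\<lambda>m. Poly_Mapping.lookup m k) ` Poly_Mapping.keys p)"
    unfolding degx_def by (rule Max_in) auto
  moreover obtain m0 where m0: "m0 \<in> Poly_Mapping.keys p" using assms by (metis keys_eq_empty ex_in_conv)
  ultimately consider "degx k p = 0" | m where "m \<in> Poly_Mapping.keys p" "Poly_Mapping.lookup m k = degx k p"
    by fastforce
  then show thesis
  proof cases
    case 1
    then show ?thesis using that[OF m0] degx_ge[OF m0, of k] by simp
  qed (rule that)
qed

definition lead_part :: "nat \<Rightarrow> mpoly \<Rightarrow> mpoly" where
  "lead_part k p = (\<Sum>m\<in>{m \<in> Poly_Mapping.keys p. Poly_Mapping.lookup m k = degx k p}.
     Poly_Mapping.single m (Poly_Mapping.lookup p m))"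

lemma lookup_lead_part:
  "Poly_Mapping.lookup (lead_part k p) m =
     (if Poly_Mapping.lookup m k = degx k p then Poly_Mapping.lookup p m else 0)"
  by (auto simp: lead_part_def lookup_sum lookup_single when_def sum.delta' in_keys_iff)

text \<open>The product of the parts of top degree in \<open>x\<^sub>k\<close> is nonzero, because polynomials form a domain, and
  all other products have smaller degree in \<open>x\<^sub>k\<close>.\<close>

lemma degx_mult:
  assumes "p \<noteq> 0" "q \<noteq> 0"
  shows "degx k (p * q) = degx k p + degx k q"
proof (rule antisym)
  show "degx k (p * q) \<le> degx k p + degx k q"
  proof (rule degx_le)
    fix m assume "m \<in> Poly_Mapping.keys (p * q)"
    then obtain a b where "m = a + b" "a \<in> Poly_Mapping.keys p" "b \<in> Poly_Mapping.keys q"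
      using keys_mult[of p q] by blast
    then show "Poly_Mapping.lookup m k \<le> degx k p + degx k q"
      using degx_ge by (simp add: lookup_add add_mono)
  qed
next
  let ?p = "lead_part k p" and ?q = "lead_part k q"
  have "lead_part k p \<noteq> 0" if "p \<noteq> 0" for p
    by (rule degx_attained[OF that, of k]) (metis in_keys_iff lookup_lead_part lookup_zero)
  then have "?p * ?q \<noteq> 0" using assms by simp
  then obtain m where m: "m \<in> Poly_Mapping.keys (?p * ?q)" by (metis keys_eq_empty ex_in_conv)
  have kl: "Poly_Mapping.lookup a k = degx k r" if "a \<in> Poly_Mapping.keys (lead_part k r)" for a r
    using that by (auto simp: in_keys_iff lookup_lead_part split: if_splits)
  have kr: "Poly_Mapping.lookup a k < degx k r" if "a \<in> Poly_Mapping.keys (r - lead_part k r)" for a r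
  proof -
    have "a \<in> Poly_Mapping.keys r" "Poly_Mapping.lookup a k \<noteq> degx k r"
      using that by (auto simp: in_keys_iff lookup_minus lookup_lead_part split: if_splits)
    then show ?thesis using degx_ge[of a r k] by simp
  qed
  obtain a b where "m = a + b" "a \<in> Poly_Mapping.keys ?p" "b \<in> Poly_Mapping.keys ?q"
    using m keys_mult[of ?p ?q] by blast
  then have mk: "Poly_Mapping.lookup m k = degx k p + degx k q" using kl by (simp add: lookup_add)
  have low: "Poly_Mapping.lookup (g * h) m = 0"
    if "\<And>a b. a \<in> Poly_Mapping.keys g \<Longrightarrow> b \<in> Poly_Mapping.keys h \<Longrightarrow>
         Poly_Mapping.lookup a k + Poly_Mapping.lookup b k < degx k p + degx k q" for g h
  proof (rule ccontr)
    assume "\<not> ?thesis"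
    then have "m \<in> Poly_Mapping.keys (g * h)" by (simp add: in_keys_iff)
    then obtain a b where "m = a + b" "a \<in> Poly_Mapping.keys g" "b \<in> Poly_Mapping.keys h"
      using keys_mult[of g h] by blast
    then show False using that[of a b] mk by (simp add: lookup_add)
  qed
  have "p * q = ?p * ?q + ((p - ?p) * ?q + ?p * (q - ?q) + (p - ?p) * (q - ?q))"
    by (simp add: algebra_simps)
  moreover have "Poly_Mapping.lookup ((p - ?p) * ?q) m = 0"
    by (rule low) (use kl kr in fastforce)
  moreover have "Poly_Mapping.lookup (?p * (q - ?q)) m = 0"
    by (rule low) (use kl kr in fastforce)
  moreover have "Poly_Mapping.lookup ((p - ?p) * (q - ?q)) m = 0"
    by (rule low) (use kr in \<open>simp add: add_strict_mono\<close>)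
  ultimately have "Poly_Mapping.lookup (p * q) m = Poly_Mapping.lookup (?p * ?q) m"
    by (metis add.right_neutral lookup_add)
  then have "m \<in> Poly_Mapping.keys (p * q)" using m by (simp add: in_keys_iff)
  then show "degx k p + degx k q \<le> degx k (p * q)" using degx_ge mk by metis
qed

lemma degx_one [simp]: "degx k 1 = 0"
  by (simp add: degx_def)

lemma degx_prod_list:
  "0 \<notin> set gs \<Longrightarrow> degx k (prod_list gs) = (\<Sum>g\<leftarrow>gs. degx k g)"
  by (induction gs) (auto simp: degx_mult prod_list_zero_iff)

lemma degx_outside: "p \<in> mpolys n \<Longrightarrow> n \<le> k \<Longrightarrow> degx k p = 0"
proof -
  assume p: "p \<in> mpolys n" "n \<le> k"
  have "degx k p \<le> 0"
  proof (rule degx_le)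
    fix m assume "m \<in> Poly_Mapping.keys p"
    then have "k \<notin> Poly_Mapping.keys m" using p by (fastforce simp: mpolys_def)
    then show "Poly_Mapping.lookup m k \<le> 0" by (simp add: in_keys_iff)
  qed
  then show ?thesis by simp
qed

lemma prod_list_in_mpolys: "set gs \<subseteq> mpolys n \<Longrightarrow> prod_list gs \<in> mpolys n"
proof (induction gs)
  case Nil
  then show ?case by (simp add: mpolys_def)
next
  case (Cons g gs)
  show ?case
    unfolding mpolys_def
  proof (intro CollectI ballI)
    fix m assume "m \<in> Poly_Mapping.keys (prod_list (g # gs))"
    then have "m \<in> Poly_Mapping.keys (g * prod_list gs)" by simp
    then obtain a b where ab: "m = a + b" "a \<in> Poly_Mapping.keys g" "b \<in> Poly_Mapping.keys (prod_list gs)"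
      using keys_mult[of g "prod_list gs"] by blast
    have "Poly_Mapping.keys a \<subseteq> {..<n}" "Poly_Mapping.keys b \<subseteq> {..<n}"
      using ab Cons by (auto simp: mpolys_def)
    then show "Poly_Mapping.keys m \<subseteq> {..<n}" using keys_add[of a b] ab(1) by auto
  qed
qed

lemma mpoly_unit_degx: "mpoly_unit n p \<Longrightarrow> degx k p = 0"
proof -
  assume "mpoly_unit n p"
  then obtain q where q: "p * q = 1" by (auto simp: mpoly_unit_def)
  then have "p \<noteq> 0" "q \<noteq> 0" by auto
  then have "degx k p + degx k q = degx k 1" using degx_mult q by metis
  then show ?thesis by simp
qed

lemma mpoly_constant_unit:
  assumes "p \<noteq> 0" "p \<in> mpolys n" "\<And>k. degx k p = 0"
  shows "mpoly_unit n p"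
proof -
  have keys: "m = 0" if "m \<in> Poly_Mapping.keys p" for m
    by (rule poly_mapping_eqI) (use degx_ge[OF that] assms(3) in \<open>metis le_zero_eq lookup_zero\<close>)
  define c where "c = Poly_Mapping.lookup p 0"
  have p: "p = Const c"
  proof (rule poly_mapping_eqI)
    fix m
    show "Poly_Mapping.lookup p m = Poly_Mapping.lookup (Const c) m"
      using keys[of m] by (cases "m = 0") (auto simp: Const_def c_def lookup_single when_def in_keys_iff)
  qed
  then have "c \<noteq> 0" using assms(1) by (auto simp: Const_zero)
  then have "p * Const (1 / c) = 1" by (simp add: p Const_mult[symmetric] Const_one)
  moreover have "Const (1 / c) \<in> mpolys n" by (simp add: mpolys_def Const_def)
  ultimately show ?thesis using assms(2) by (auto simp: mpoly_unit_def)
qed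

lemma sum_of_squarefree_terms:
  assumes "finite V" "Poly_Mapping.keys g \<subseteq> monom_of ` Pow V"
  shows "g = (\<Sum>U\<in>Pow V. Poly_Mapping.single (monom_of U) (Poly_Mapping.lookup g (monom_of U)))"
proof (rule poly_mapping_eqI)
  fix m
  have inj: "inj_on monom_of (Pow V)"
    by (rule inj_on_subset[OF inj_on_monom_of]) (use assms(1) in \<open>auto intro: finite_subset\<close>)
  have "Poly_Mapping.lookup (\<Sum>U\<in>Pow V. Poly_Mapping.single (monom_of U) (Poly_Mapping.lookup g (monom_of U))) m
     = (\<Sum>m'\<in>monom_of ` Pow V. if m' = m then Poly_Mapping.lookup g m else 0)"
    unfolding sum.reindex[OF inj] lookup_sum by (intro sum.cong) (auto simp: lookup_single when_def)
  also have "\<dots> = Poly_Mapping.lookup g m"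
    using assms by (auto simp: sum.delta in_keys_iff)
  finally show "Poly_Mapping.lookup g m = Poly_Mapping.lookup (\<Sum>U\<in>Pow V. Poly_Mapping.single (monom_of U) (Poly_Mapping.lookup g (monom_of U))) m"
    by simp
qed

text \<open>A squarefree monomial in the variables of \<open>V \<union> W\<close> splits uniquely into a part from \<open>V\<close> and a part from
  \<open>W\<close>, so only one product of terms contributes.\<close>

lemma lookup_mult_disjoint:
  assumes fin: "finite V" "finite W" and disj: "V \<inter> W = {}"
    and g: "Poly_Mapping.keys g \<subseteq> monom_of ` Pow V" and r: "Poly_Mapping.keys r \<subseteq> monom_of ` Pow W"
    and sub: "U \<subseteq> V" "U' \<subseteq> W"
  shows "Poly_Mapping.lookup (g * r) (monom_of (U \<union> U')) =
    Poly_Mapping.lookup g (monom_of U) * Poly_Mapping.lookup r (monom_of U')"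
proof -
  let ?g = "\<lambda>B. Poly_Mapping.lookup g (monom_of B)" and ?r = "\<lambda>B. Poly_Mapping.lookup r (monom_of B)"
  have "g * r = (\<Sum>B\<in>Pow V. Poly_Mapping.single (monom_of B) (?g B)) *
      (\<Sum>C\<in>Pow W. Poly_Mapping.single (monom_of C) (?r C))"
    using sum_of_squarefree_terms[OF fin(1) g] sum_of_squarefree_terms[OF fin(2) r] by simp
  also have "\<dots> = (\<Sum>B\<in>Pow V. \<Sum>C\<in>Pow W. Poly_Mapping.single (monom_of B + monom_of C) (?g B * ?r C))"
    by (simp add: sum_product mult_single)
  finally have "Poly_Mapping.lookup (g * r) (monom_of (U \<union> U')) =
      (\<Sum>B\<in>Pow V. \<Sum>C\<in>Pow W. Poly_Mapping.lookup (Poly_Mapping.single (monom_of B + monom_of C) (?g B * ?r C)) (monom_of (U \<union> U')))"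
    by (simp add: lookup_sum)
  also have "\<dots> = (\<Sum>B\<in>Pow V. \<Sum>C\<in>Pow W. if C = U' then (if B = U then ?g B * ?r C else 0) else 0)"
  proof (intro sum.cong refl)
    fix B C assume BC: "B \<in> Pow V" "C \<in> Pow W"
    then have f: "finite B" "finite C" "finite (U \<union> U')" "B \<inter> C = {}"
      using fin sub disj by (auto intro: finite_subset)
    have "B \<union> C = U \<union> U' \<longleftrightarrow> B = U \<and> C = U'"
      using BC sub disj by blast
    then show "Poly_Mapping.lookup (Poly_Mapping.single (monom_of B + monom_of C) (?g B * ?r C)) (monom_of (U \<union> U'))
      = (if C = U' then (if B = U then ?g B * ?r C else 0) else 0)"
      using f by (auto simp: monom_of_Un lookup_single when_def monom_of_eq_iff)
  qed
  also have "\<dots> = ?g U * ?r U'"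
    using fin sub by (simp add: sum.delta)
  finally show ?thesis .
qed

lemma degx_det_poly:
  assumes "A \<in> carrier_mat n n" "T \<subseteq> {..<n}"
  shows "degx k (det_poly A T) = (if k \<in> T then 1 else 0)"
proof (rule antisym)
  have fin: "finite T" using assms(2) finite_subset by blast
  show "degx k (det_poly A T) \<le> (if k \<in> T then 1 else 0)"
  proof (rule degx_le)
    fix m assume "m \<in> Poly_Mapping.keys (det_poly A T)"
    then obtain U where U: "U \<subseteq> T" "m = monom_of U" using keys_det_poly[OF assms] by auto
    then have "finite U" using fin finite_subset by blast
    then show "Poly_Mapping.lookup m k \<le> (if k \<in> T then 1 else 0)" using U by (auto simp: lookup_monom_of)
  qed
  have "monom_of T \<in> Poly_Mapping.keys (det_poly A T)"
    by (simp add: in_keys_iff lookup_det_poly[OF assms subset_refl])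
  from degx_ge[OF this, of k] show "(if k \<in> T then 1 else 0) \<le> degx k (det_poly A T)"
    by (simp add: lookup_monom_of[OF fin])
qed

lemma det_poly_nonzero:
  assumes "A \<in> carrier_mat n n" "T \<subseteq> {..<n}"
  shows "det_poly A T \<noteq> 0"
  using lookup_det_poly[OF assms subset_refl] by auto

text \<open>A block of zeros would factor the determinant into two determinantal polynomials of positive degree.\<close>

lemma irreducible_det_poly_imp_strongly_connected:
  assumes "A \<in> carrier_mat n n" "T \<subseteq> {..<n}" "mpoly_irreducible n (det_poly A T)"
  shows "strongly_connected T (entry A)"
  unfolding strongly_connected_def
proof (intro allI impI, rule ccontr)
  fix U assume U: "U \<subset> T" "U \<noteq> {}" and "\<not> (\<exists>i\<in>U. \<exists>j\<in>T - U. entry A i j \<noteq> 0)"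
  then have z: "add_diag (\<lambda>i j. Const (entry A i j)) X i j = 0" if "i \<in> U" "j \<in> T - U" for i j
    using that by (auto simp: add_diag_def Const_zero)
  have s: "U \<subseteq> {..<n}" "T - U \<subseteq> {..<n}" "U \<subseteq> T" using U assms(2) by auto
  have "finite T" using assms(2) finite_subset by blast
  from pdet_block_triangular[OF this s(3) z]
  have "det_poly A T = det_poly A U * det_poly A (T - U)"
    by (simp add: det_poly_eq_pdet[OF assms(1)] assms(2) s)
  then have "mpoly_unit n (det_poly A U) \<or> mpoly_unit n (det_poly A (T - U))"
    using assms(3) det_poly_in_mpolys[OF assms(1) s(1)] det_poly_in_mpolys[OF assms(1) s(2)]
    unfolding mpoly_irreducible_def by blast
  moreover obtain k l where "k \<in> U" "l \<in> T - U" using U by blast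
  ultimately show False
    using mpoly_unit_degx[of n "det_poly A U" k] mpoly_unit_degx[of n "det_poly A (T - U)" l]
      degx_det_poly[OF assms(1) s(1)] degx_det_poly[OF assms(1) s(2)] by (metis zero_neq_one)
qed

text \<open>Since \<open>det_poly A {..<n}\<close> has degree 1 in each variable, \<open>g\<close> and \<open>r\<close> use complementary sets \<open>V\<close> and \<open>W\<close> of
  variables, each to degree at most 1. The coefficients of the product are principal minors of \<open>A\<close> on the one
  hand and products of coefficients of \<open>g\<close> and \<open>r\<close> on the other. With the full monomial of \<open>W\<close> this
  identifies \<open>g\<close>, and it shows that principal minors multiply across \<open>V\<close> and \<open>W\<close>; for one index
  on each side that is the last claim.\<close>

lemma factor_of_det_poly:
  assumes A: "A \<in> carrier_mat n n" and fac: "det_poly A {..<n} = g * r"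
    and gr: "g \<in> mpolys n" "r \<in> mpolys n" and top: "top_normalized g"
  defines "V \<equiv> {k. 0 < degx k g}"
  shows "V \<subseteq> {..<n}" "g = det_poly A V"
    "\<And>i j. i \<in> V \<Longrightarrow> j \<in> {..<n} - V \<Longrightarrow> entry A i j * entry A j i = 0"
proof -
  let ?W = "{..<n} - V"
  have nz: "g \<noteq> 0" "r \<noteq> 0" using fac det_poly_nonzero[OF A subset_refl] by auto
  have deg: "degx k g + degx k r = (if k < n then 1 else 0)" for k
    using degx_mult[OF nz] degx_det_poly[OF A subset_refl] fac by (metis lessThan_iff)
  show V: "V \<subseteq> {..<n}"
  proof
    fix k assume "k \<in> V"
    then show "k \<in> {..<n}"
      using degx_outside[OF gr(1), of k] by (cases "k < n") (auto simp: V_def)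
  qed
  then have fin: "finite V" "finite ?W" using finite_subset by auto
  have sqfree: "Poly_Mapping.keys h \<subseteq> monom_of ` Pow Z"
    if "\<And>k. degx k h \<le> (if k \<in> Z then 1 else 0)" for h Z
  proof
    fix m assume m: "m \<in> Poly_Mapping.keys h"
    have le: "Poly_Mapping.lookup m k \<le> (if k \<in> Z then 1 else 0)" for k
      using degx_ge[OF m, of k] that[of k] by (rule order_trans)
    have "Poly_Mapping.lookup m k \<le> 1" for k using le[of k] by (simp split: if_splits)
    then have "m = monom_of (Poly_Mapping.keys m)" by (rule monom_of_keys)
    moreover have "Poly_Mapping.keys m \<subseteq> Z"
    proof
      fix k assume "k \<in> Poly_Mapping.keys m"
      then show "k \<in> Z" using le[of k] by (simp add: in_keys_iff split: if_splits)
    qed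
    ultimately show "m \<in> monom_of ` Pow Z" by blast
  qed
  have deg_le: "degx k g \<le> (if k \<in> V then 1 else 0)" "degx k r \<le> (if k \<in> ?W then 1 else 0)" for k
    using deg[of k] by (auto simp: V_def split: if_splits)
  have gk: "Poly_Mapping.keys g \<subseteq> monom_of ` Pow V"
    by (rule sqfree) (rule deg_le)
  have rk: "Poly_Mapping.keys r \<subseteq> monom_of ` Pow ?W"
    by (rule sqfree) (rule deg_le)
  let ?g = "\<lambda>U. Poly_Mapping.lookup g (monom_of U)" and ?r = "\<lambda>U. Poly_Mapping.lookup r (monom_of U)"
  have coeff: "pdet ((V - U) \<union> (?W - U')) (entry A) = ?g U * ?r U'" if "U \<subseteq> V" "U' \<subseteq> ?W" for U U'
  proof -
    have "U \<union> U' \<subseteq> {..<n}" using that V by auto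
    from lookup_det_poly[OF A subset_refl this]
    have "pdet ({..<n} - (U \<union> U')) (entry A) = ?g U * ?r U'"
      unfolding fac using lookup_mult_disjoint[OF fin _ gk rk that] by auto
    moreover have "{..<n} - (U \<union> U') = (V - U) \<union> (?W - U')" using that V by auto
    ultimately show ?thesis by simp
  qed
  have "?g V * ?r ?W = 1" using coeff[of V ?W] by simp
  (* The monomial of all variables in V occurs in g, hence it is the monomial of top degree that carries the
     coefficient 1. *)
  have "?g V = 1"
  proof -
    obtain m where m: "m \<in> Poly_Mapping.keys g" "Poly_Mapping.lookup g m = 1"
      and max: "\<And>m'. m' \<in> Poly_Mapping.keys g \<Longrightarrow> monom_degree m' \<le> monom_degree m"
      using top unfolding top_normalized_def by blast
    obtain U where U: "U \<subseteq> V" "m = monom_of U" using m(1) gk by auto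
    have "monom_of V \<in> Poly_Mapping.keys g" using \<open>?g V * ?r ?W = 1\<close> by (auto simp: in_keys_iff)
    then have "card V \<le> card U"
      using max[of "monom_of V"] U fin finite_subset[OF U(1)] by (simp add: monom_degree_monom_of)
    then have "U = V" using U(1) fin(1) by (simp add: card_seteq)
    then show ?thesis using U m by simp
  qed
  then have "?r ?W = 1" using \<open>?g V * ?r ?W = 1\<close> by simp
  have gU: "?g U = pdet (V - U) (entry A)" if "U \<subseteq> V" for U
    using coeff[OF that subset_refl] \<open>?r ?W = 1\<close> by simp
  have rU: "?r U = pdet (?W - U) (entry A)" if "U \<subseteq> ?W" for U
    using coeff[OF subset_refl that] \<open>?g V = 1\<close> by simp
  show "g = det_poly A V"
  proof (rule poly_mapping_eqI)
    fix m
    show "Poly_Mapping.lookup g m = Poly_Mapping.lookup (det_poly A V) m"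
    proof (cases "m \<in> monom_of ` Pow V")
      case True
      then show ?thesis using gU lookup_det_poly[OF A V] by auto
    next
      case False
      then have "m \<notin> Poly_Mapping.keys g" "m \<notin> Poly_Mapping.keys (det_poly A V)"
        using gk keys_det_poly[OF A V] by auto
      then show ?thesis by (simp add: in_keys_iff)
    qed
  qed
  fix i j assume i: "i \<in> V" and j: "j \<in> ?W"
  have sets: "V - (V - {i}) = {i}" "?W - (?W - {j}) = {j}" using i j by auto
  have "pdet ({i} \<union> {j}) (entry A) = pdet {i} (entry A) * pdet {j} (entry A)"
    using coeff[of "V - {i}" "?W - {j}"] gU[of "V - {i}"] rU[of "?W - {j}"] unfolding sets by auto
  moreover have "i \<noteq> j" using i j by auto
  ultimately show "entry A i j * entry A j i = 0" by (auto simp: pdet_pair insert_is_Un[symmetric])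
qed


section \<open>Matrices: irreducibility and Hermitian conjugates\<close>

lemma strongly_connected_transport:
  assumes "strongly_connected V a" "bij_betw h {..<m} V"
    and "\<And>i j. i < m \<Longrightarrow> j < m \<Longrightarrow> b i j = a (h i) (h j)"
  shows "strongly_connected {..<m} b"
  unfolding strongly_connected_def
proof (intro allI impI)
  fix T assume T: "T \<subset> {..<m}" "T \<noteq> {}"
  have inj: "inj_on h {..<m}" and im: "h ` {..<m} = V" using assms(2) by (auto simp: bij_betw_def)
  have "h ` T \<subset> h ` {..<m}"
    by (rule image_strict_mono[OF inj T(1)])
  then have "h ` T \<subset> V" "h ` T \<noteq> {}" using T by (simp_all add: im)
  from strongly_connectedE[OF assms(1) this]
  obtain i j where ij: "i \<in> h ` T" "j \<in> V - h ` T" "a i j \<noteq> 0" .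
  obtain i' j' where "i' \<in> T" "i = h i'" "j' \<in> {..<m}" "j = h j'" using ij im by blast
  then have "i' \<in> T" "j' \<in> {..<m} - T" "b i' j' \<noteq> 0"
    using ij T assms(3)[of i' j'] by auto
  then show "\<exists>i\<in>T. \<exists>j\<in>{..<m} - T. b i j \<noteq> 0" by blast
qed

lemma hermitizable_transport:
  assumes "hermitizable V a" "\<And>i. i < m \<Longrightarrow> h i \<in> V"
    and "\<And>i j. i < m \<Longrightarrow> j < m \<Longrightarrow> b i j = a (h i) (h j)"
  shows "hermitizable {..<m} b"
proof -
  obtain p :: "nat \<Rightarrow> real" where "\<forall>i\<in>V. 0 < p i"
    "\<forall>i\<in>V. \<forall>j\<in>V. a i j * complex_of_real (p j) = complex_of_real (p i) * cnj (a j i)"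
    using assms(1) unfolding hermitizable_def by metis
  then show ?thesis
    unfolding hermitizable_def by (intro exI[of _ "p \<circ> h"]) (simp add: assms(2,3))
qed

lemma block_range_cover:
  assumes "j < sum_list (take p ns)" "p \<le> length ns"
  obtains q where "q < p" "j \<in> block_range ns q"
  using assms
proof (induction p arbitrary: thesis)
  case 0
  then show ?case by simp
next
  case (Suc p)
  show ?case
  proof (cases "j < sum_list (take p ns)")
    case True
    then show ?thesis using Suc.IH[of thesis] Suc.prems by (metis Suc_leD less_SucI)
  next
    case False
    then have "j \<in> block_range ns p" using Suc.prems(2) by (simp add: block_range_def)
    then show ?thesis using Suc.prems(1) by blast
  qed
qed

text \<open>In a block triangular form with at least two blocks no edge leaves the index set of the last block.\<close>

lemma strongly_connected_imp_irreducible_mat: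
  assumes M: "M \<in> carrier_mat m m" and conn: "strongly_connected {..<m} (entry M)"
  shows "irreducible_mat M"
proof -
  have False if red: "reducible_mat M"
  proof -
    obtain \<pi> ns where pi: "\<pi> permutes {..<m}" and len: "2 \<le> length ns"
      and tri: "block_upper_triangular ns (permute_mat \<pi> M)"
      using red M by (auto simp: reducible_mat_def)
    have sum: "sum_list ns = m" and pos: "\<forall>k\<in>set ns. 0 < k"
      using tri M by (auto simp: block_upper_triangular_def permute_mat_def)
    define p where "p = length ns - 1"
    have p: "0 < p" "Suc p = length ns" using len by (auto simp: p_def)
    let ?l = "sum_list (take p ns)"
    have R: "block_range ns p = {?l..<m}" using p sum by (simp add: block_range_def)
    have "p < length ns" using p by simp
    from take_Suc_conv_app_nth[OF this] have "sum_list (take (Suc p) ns) = ?l + ns ! p" by simp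
    then have m: "m = ?l + ns ! p" using p sum by simp
    have "0 < ns ! p" using pos p by simp
    moreover have "0 < ?l"
    proof -
      have "ns ! 0 \<in> set (take p ns)" using p by (metis length_take lessI less_SucI min_less_iff_conj nth_mem nth_take)
      then have "ns ! 0 \<le> ?l" by (rule member_le_sum_list) simp
      moreover have "0 < ns ! 0" using pos p by (metis nth_mem zero_less_Suc)
      ultimately show ?thesis by simp
    qed
    ultimately have l: "0 < ?l" "?l < m" using m by linarith+
    have "{l..<m} \<subset> {..<m} \<and> {l..<m} \<noteq> {}" if "0 < l" "l < m" for l
    proof -
      have "0 \<in> {..<m}" "0 \<notin> {l..<m}" "l \<in> {l..<m}" "{l..<m} \<subseteq> {..<m}" using that by auto
      then show ?thesis by blast
    qed
    from this[OF l] have "{?l..<m} \<subset> {..<m}" "{?l..<m} \<noteq> {}" by blast+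
    then have "\<pi> ` {?l..<m} \<subset> \<pi> ` {..<m}" "\<pi> ` {?l..<m} \<noteq> {}"
      using image_strict_mono[OF permutes_inj_on[OF pi]] by auto
    then have "\<pi> ` {?l..<m} \<subset> {..<m}" by (simp add: permutes_image[OF pi])
    from strongly_connectedE[OF conn this \<open>\<pi> ` {?l..<m} \<noteq> {}\<close>]
    obtain i j where ij: "i \<in> \<pi> ` {?l..<m}" "j \<in> {..<m} - \<pi> ` {?l..<m}" "M $$ (i, j) \<noteq> 0" .
    obtain i' where i': "i = \<pi> i'" "i' \<in> {?l..<m}" using ij(1) by blast
    have "j \<in> \<pi> ` {..<m}" using ij(2) permutes_image[OF pi] by simp
    then obtain j' where j': "j = \<pi> j'" "j' < m" by auto
    then have "j' < ?l" using ij(2) by (metis DiffD2 atLeastLessThan_iff imageI leI)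
    then obtain q where "q < p" "j' \<in> block_range ns q" using p by (auto elim: block_range_cover)
    then have "permute_mat \<pi> M $$ (i', j') = 0"
      using tri p i' unfolding block_upper_triangular_def R[symmetric] by (metis lessI)
    then show False using ij(3) i' j' M by (simp add: permute_mat_def)
  qed
  then show ?thesis using M by (auto simp: irreducible_mat_def)
qed

lemma mat_adjoint_index:
  assumes "A \<in> carrier_mat n n" "i < n" "j < n"
  shows "mat_adjoint A $$ (i, j) = cnj (A $$ (j, i))"
  using assms by (simp add: mat_adjoint_def mat_of_rows_index)

text \<open>Conjugation by the diagonal matrix with entries \<open>sqrt (p i)\<close>.\<close>

lemma hermitizable_imp_diag_equiv_hermitian:
  assumes M: "M \<in> carrier_mat m m" and herm: "hermitizable {..<m} (entry M)"
    and conn: "strongly_connected {..<m} (entry M)"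
  obtains H where "H \<in> carrier_mat m m" "hermitian_mat H" "irreducible_mat H" "diag_equiv M H"
    "\<And>S. S \<subseteq> {..<m} \<Longrightarrow> det (submatrix H S S) = det (submatrix M S S)"
proof -
  obtain p :: "nat \<Rightarrow> real" where p: "\<And>i. i < m \<Longrightarrow> 0 < p i"
    and sym: "\<And>i j. i < m \<Longrightarrow> j < m \<Longrightarrow> M $$ (i, j) * complex_of_real (p j) = complex_of_real (p i) * cnj (M $$ (j, i))"
    using herm unfolding hermitizable_def by (metis lessThan_iff)
  define d where "d i = complex_of_real (sqrt (p i))" for i
  have d: "d i \<noteq> 0" "cnj (d i) = d i" "d i * d i = complex_of_real (p i)" if "i < m" for i
    using p[OF that] by (auto simp: d_def simp flip: of_real_mult)
  define H where "H = mat m m (\<lambda>(i, j). M $$ (i, j) * d j / d i)"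
  have H: "H \<in> carrier_mat m m" by (simp add: H_def)
  have Hij: "H $$ (i, j) = M $$ (i, j) * d j / d i" if "i < m" "j < m" for i j
    using that by (simp add: H_def)
  have "mat_adjoint H = H"
  proof (rule eq_matI)
    fix i j assume "i < dim_row H" "j < dim_col H"
    then have ij: "i < m" "j < m" using H by auto
    have "d i * d j * cnj (H $$ (j, i)) = d i * d i * cnj (M $$ (j, i))"
      using d ij by (simp add: Hij)
    also have "\<dots> = M $$ (i, j) * (d j * d j)"
      unfolding d(3)[OF ij(1)] d(3)[OF ij(2)] by (rule sym[OF ij, symmetric])
    also have "\<dots> = d i * d j * H $$ (i, j)"
      using d(1)[OF ij(1)] ij by (simp add: Hij)
    finally show "mat_adjoint H $$ (i, j) = H $$ (i, j)"
      using d ij by (simp add: mat_adjoint_index[OF H ij])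
  qed (use H in \<open>simp_all add: mat_adjoint_def\<close>)
  then have herm_H: "hermitian_mat H" using H by (simp add: hermitian_mat_def)
  have "strongly_connected {..<m} (entry H)"
    unfolding strongly_connected_def
  proof (intro allI impI)
    fix T assume T: "T \<subset> {..<m}" "T \<noteq> {}"
    from strongly_connectedE[OF conn this]
    obtain i j where ij: "i \<in> T" "j \<in> {..<m} - T" "entry M i j \<noteq> 0" .
    then have "entry H i j \<noteq> 0" using T d by (auto simp: Hij)
    then show "\<exists>i\<in>T. \<exists>j\<in>{..<m} - T. entry H i j \<noteq> 0" using ij by blast
  qed
  then have irr: "irreducible_mat H" by (rule strongly_connected_imp_irreducible_mat[OF H])
  let ?D = "mat_diag m d" and ?D' = "mat_diag m (\<lambda>i. 1 / d i)"
  have one: "mat_diag m (\<lambda>i. d i * (1 / d i)) = 1\<^sub>m m" "mat_diag m (\<lambda>i. (1 / d i) * d i) = 1\<^sub>m m"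
    using d by (auto simp: mat_diag_def intro!: eq_matI)
  have "M = ?D * H * ?D'"
    unfolding mat_diag_mult_left[OF H]
    by (subst mat_diag_mult_right[of _ m]) (use M d in \<open>auto intro!: eq_matI simp: Hij\<close>)
  moreover have "?D \<in> carrier_mat m m" "?D' \<in> carrier_mat m m" by simp_all
  moreover have "diagonal_mat ?D" by (simp add: diagonal_mat_def mat_diag_def)
  moreover have "dim_row (mat_diag m h) = m" for h :: "nat \<Rightarrow> complex"
    by (simp add: mat_diag_def)
  then have "inverts_mat ?D ?D'" "inverts_mat ?D' ?D"
    unfolding inverts_mat_def mat_diag_diag one by simp_all
  ultimately have equiv: "diag_equiv M H" using M H unfolding diag_equiv_def by blast
  have "det (submatrix H S S) = det (submatrix M S S)" if S: "S \<subseteq> {..<m}" for S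
  proof -
    have fin: "finite S" using S finite_subset by blast
    have "pdet S (entry H) = pdet S (\<lambda>i j. entry M i j * d j / d i)"
      by (intro pdet_cong Hij) (use S in auto)
    also have "\<dots> = pdet S (entry M)"
      by (rule pdet_scale[OF fin]) (use S d in auto)
    finally show ?thesis
      by (simp add: det_submatrix_eq_pdet[OF H S] det_submatrix_eq_pdet[OF M S])
  qed
  then show thesis by (rule that[OF H herm_H irr equiv])
qed

section \<open>Ordering the strong components\<close>

text \<open>Among the nonempty sets of indices in the union \<open>U\<close> of the blocks that no edge leaves inside \<open>U\<close>, a
  smallest one, \<open>T\<close>, is strongly connected. It swallows every block it meets. If it contained anything besides one
  block, some edge would leave that block within \<open>T\<close>, and its reverse would also be nonzero because \<open>T\<close> is hermitizable;
  but entries across blocks have product zero. So \<open>T\<close> is a single block, and no edge leaves it.\<close>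

lemma ex_sink_block:
  assumes ray: "rayleigh S a" "finite S"
    and J: "J \<noteq> {}" and sub: "\<And>q. q \<in> J \<Longrightarrow> V q \<subseteq> S" and ne: "\<And>q. q \<in> J \<Longrightarrow> V q \<noteq> {}"
    and conn: "\<And>q. q \<in> J \<Longrightarrow> strongly_connected (V q) a"
    and cross: "\<And>q r i j. q \<in> J \<Longrightarrow> r \<in> J \<Longrightarrow> q \<noteq> r \<Longrightarrow> i \<in> V q \<Longrightarrow> j \<in> V r \<Longrightarrow> a i j * a j i = 0"
    and disj: "\<And>q r. q \<in> J \<Longrightarrow> r \<in> J \<Longrightarrow> q \<noteq> r \<Longrightarrow> V q \<inter> V r = {}"
  obtains q where "q \<in> J" "\<And>r i j. r \<in> J - {q} \<Longrightarrow> i \<in> V q \<Longrightarrow> j \<in> V r \<Longrightarrow> a i j = 0"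
proof -
  define U where "U = (\<Union>q\<in>J. V q)"
  define closed_in where "closed_in T \<longleftrightarrow> T \<subseteq> U \<and> T \<noteq> {} \<and> (\<forall>i\<in>T. \<forall>j\<in>U - T. a i j = 0)" for T
  have "U \<subseteq> S" using sub by (auto simp: U_def)
  then have finU: "finite U" using ray(2) finite_subset by blast
  have "closed_in U" using J ne by (auto simp: closed_in_def U_def)
  then obtain T where T: "closed_in T" and min: "\<And>T'. closed_in T' \<Longrightarrow> card T \<le> card T'"
    using ex_has_least_nat[of closed_in U card] by blast
  have TU: "T \<subseteq> U" and Tne: "T \<noteq> {}" and out: "\<And>i j. i \<in> T \<Longrightarrow> j \<in> U - T \<Longrightarrow> a i j = 0"
    using T by (auto simp: closed_in_def)
  have finT: "finite T" using TU finU finite_subset by blast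
  have connT: "strongly_connected T a"
    unfolding strongly_connected_def
  proof (intro allI impI, rule ccontr)
    fix T' assume T': "T' \<subset> T" "T' \<noteq> {}" and no: "\<not> (\<exists>i\<in>T'. \<exists>j\<in>T - T'. a i j \<noteq> 0)"
    have "a i j = 0" if "i \<in> T'" "j \<in> U - T'" for i j
      using that no out[of i j] T'(1) by (cases "j \<in> T") auto
    then have "closed_in T'" using T' TU by (auto simp: closed_in_def)
    then show False using min[of T'] psubset_card_mono[OF finT T'(1)] by simp
  qed
  have "rayleigh T a" using rayleigh_subset[OF ray(2,1)] TU \<open>U \<subseteq> S\<close> by blast
  then have "hermitizable T a" using rayleigh_imp_hermitizable finT connT by blast
  then obtain p :: "nat \<Rightarrow> real" where p: "\<And>i. i \<in> T \<Longrightarrow> 0 < p i"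
    and sym: "\<And>i j. i \<in> T \<Longrightarrow> j \<in> T \<Longrightarrow> a i j * complex_of_real (p j) = complex_of_real (p i) * cnj (a j i)"
    unfolding hermitizable_def by metis
  obtain k where k: "k \<in> T" using Tne by blast
  then obtain q where q: "q \<in> J" "k \<in> V q" using TU by (auto simp: U_def)
  have "V q \<subseteq> T"
  proof (rule ccontr)
    assume "\<not> V q \<subseteq> T"
    then have "T \<inter> V q \<subset> V q" "T \<inter> V q \<noteq> {}" using k q by auto
    from strongly_connectedE[OF conn[OF q(1)] this]
    obtain i j where "i \<in> T \<inter> V q" "j \<in> V q - (T \<inter> V q)" "a i j \<noteq> 0" .
    then show False using out[of i j] q by (auto simp: U_def)
  qed
  moreover have "T \<subseteq> V q"
  proof (rule ccontr)
    assume "\<not> T \<subseteq> V q"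
    then have "V q \<subset> T" using \<open>V q \<subseteq> T\<close> by auto
    from strongly_connectedE[OF connT this ne[OF q(1)]]
    obtain i j where ij: "i \<in> V q" "j \<in> T - V q" "a i j \<noteq> 0" .
    obtain r where r: "r \<in> J" "j \<in> V r" using ij(2) TU by (auto simp: U_def)
    then have "a j i = 0" using cross[of q r i j] q ij by auto
    then have "a i j * complex_of_real (p j) = 0" using sym[of i j] ij \<open>V q \<subset> T\<close> by auto
    then show False using ij p[of j] by auto
  qed
  ultimately have "T = V q" by simp
  then have "a i j = 0" if "r \<in> J - {q}" "i \<in> V q" "j \<in> V r" for r i j
    using out[of i j] disj[of q r] that q(1) by (auto simp: U_def)
  then show thesis using that q(1) by blast
qed

text \<open>Sinks are removed one after another and put at the end.\<close>

lemma ex_block_order: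
  assumes "finite J"
    and sink: "\<And>J'. J' \<subseteq> J \<Longrightarrow> J' \<noteq> {} \<Longrightarrow> \<exists>q\<in>J'. \<forall>r\<in>J' - {q}. E q r"
  shows "\<exists>L. distinct L \<and> set L = J \<and> (\<forall>p<length L. \<forall>q<p. E (L ! p) (L ! q))"
  using assms
proof (induction J rule: finite_psubset_induct)
  case (psubset J)
  show ?case
  proof (cases "J = {}")
    case True
    then show ?thesis by simp
  next
    case False
    then obtain s where s: "s \<in> J" "\<forall>r\<in>J - {s}. E s r" using psubset.prems[of J] by blast
    have "\<exists>L. distinct L \<and> set L = J - {s} \<and> (\<forall>p<length L. \<forall>q<p. E (L ! p) (L ! q))"
    proof (rule psubset.IH)
      show "J - {s} \<subset> J" using s by auto
      show "\<exists>q\<in>J'. \<forall>r\<in>J' - {q}. E q r" if "J' \<subseteq> J - {s}" "J' \<noteq> {}" for J'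
        using psubset.prems[of J'] that by blast
    qed
    then obtain L where L: "distinct L" "set L = J - {s}" "\<forall>p<length L. \<forall>q<p. E (L ! p) (L ! q)"
      by blast
    have "E ((L @ [s]) ! p) ((L @ [s]) ! q)" if "p < length (L @ [s])" "q < p" for p q
    proof (cases "p < length L")
      case True
      then show ?thesis using L(3) that by (simp add: nth_append)
    next
      case False
      then have "p = length L" using that by simp
      then show ?thesis using that s(2) L(2) nth_mem[of q L] by (simp add: nth_append)
    qed
    then show ?thesis using L s by (intro exI[of _ "L @ [s]"]) auto
  qed
qed

lemma permutes_of_list:
  assumes "distinct xs" "set xs = {..<m}"
  shows "(\<lambda>i. if i < m then xs ! i else i) permutes {..<m}"
proof (rule bij_imp_permutes)
  have len: "length xs = m" using distinct_card[OF assms(1)] assms(2) by simp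
  have "bij_betw ((!) xs) {..<m} {..<m}" using bij_betw_nth[OF assms(1)] len assms(2) by blast
  then show "bij_betw (\<lambda>i. if i < m then xs ! i else i) {..<m} {..<m}"
    by (rule bij_betw_cong[THEN iffD1, rotated]) simp
qed simp

text \<open>The concatenation of the sorted blocks lists \<open>{..<n}\<close> without repetition and is read as a permutation. Nonempty
  blocks are required so that different positions in \<open>L\<close> give different lists.\<close>

lemma ex_permutation_to_blocks:
  assumes L: "distinct L" "set L = J"
    and fin: "\<And>q. q \<in> J \<Longrightarrow> finite (V q)" and ne: "\<And>q. q \<in> J \<Longrightarrow> V q \<noteq> {}"
    and part: "(\<Union>q\<in>J. V q) = {..<n}" "\<And>q r. q \<in> J \<Longrightarrow> r \<in> J \<Longrightarrow> q \<noteq> r \<Longrightarrow> V q \<inter> V r = {}"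
  defines "ns \<equiv> map (\<lambda>q. card (V q)) L"
  shows "sum_list ns = n"
    and "\<exists>\<pi>. \<pi> permutes {..<n} \<and> (\<forall>p<length L. \<pi> ` block_range ns p = V (L ! p))"
proof -
  define ps where "ps = map (\<lambda>q. sorted_list_of_set (V q)) L"
  define xs where "xs = concat ps"
  have lens: "map length ps = ns" using L fin by (auto simp: ps_def ns_def)
  have set_ps: "set (ps ! p) = V (L ! p)" if "p < length L" for p
    using that L fin nth_mem[OF that] by (simp add: ps_def)
  have "set xs = {..<n}" using L part(1) fin by (auto simp: xs_def ps_def)
  moreover have "distinct xs"
    unfolding xs_def
  proof (rule distinct_concat)
    have "inj_on (\<lambda>q. sorted_list_of_set (V q)) J"
    proof (rule inj_onI)
      fix q r assume qr: "q \<in> J" "r \<in> J" "sorted_list_of_set (V q) = sorted_list_of_set (V r)"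
      then have "V q = V r" using fin by (metis set_sorted_list_of_set)
      then show "q = r" using part(2)[of q r] ne[of q] qr by auto
    qed
    then show "distinct ps" using L by (simp add: ps_def distinct_map)
    show "distinct ys" if "ys \<in> set ps" for ys using that by (auto simp: ps_def)
    fix ys zs assume yz: "ys \<in> set ps" "zs \<in> set ps" "ys \<noteq> zs"
    then obtain q r where "q \<in> J" "r \<in> J" "ys = sorted_list_of_set (V q)" "zs = sorted_list_of_set (V r)"
      using L(2) by (auto simp: ps_def)
    then show "set ys \<inter> set zs = {}" using part(2)[of q r] fin yz(3) by auto
  qed
  ultimately have perm: "(\<lambda>i. if i < n then xs ! i else i) permutes {..<n}"
    using permutes_of_list by blast
  have "length xs = n" using distinct_card[OF \<open>distinct xs\<close>] \<open>set xs = {..<n}\<close> by simp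
  then show sum: "sum_list ns = n" by (simp add: xs_def length_concat lens)
  have "(\<lambda>i. if i < n then xs ! i else i) ` block_range ns p = V (L ! p)" if p: "p < length L" for p
  proof -
    let ?l = "sum_list (take p ns)"
    have pl: "p < length ps" "p < length ns" using p by (simp_all add: ps_def ns_def)
    have l: "length (concat (take p ps)) = ?l" by (simp add: length_concat take_map[symmetric] lens)
    have np: "ns ! p = length (ps ! p)" using pl by (simp add: lens[symmetric])
    have xs: "xs = concat (take p ps) @ ps ! p @ concat (drop (Suc p) ps)"
      unfolding xs_def by (subst id_take_nth_drop[OF pl(1)]) simp
    have R: "block_range ns p = {?l..<?l + length (ps ! p)}"
      using pl np by (simp add: block_range_def take_Suc_conv_app_nth)
    have "?l + length (ps ! p) \<le> n" using \<open>length xs = n\<close> l xs by (metis (no_types, lifting) append_assoc le_add1 length_append)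
    have nth: "xs ! (?l + i) = ps ! p ! i" if "i < length (ps ! p)" for i
      using that by (simp add: xs nth_append l)
    have "(\<lambda>i. if i < n then xs ! i else i) ` block_range ns p = (!) xs ` {?l..<?l + length (ps ! p)}"
      unfolding R by (rule image_cong) (use \<open>?l + length (ps ! p) \<le> n\<close> in auto)
    also have "{?l..<?l + length (ps ! p)} = (+) ?l ` {..<length (ps ! p)}"
      by (simp add: lessThan_atLeast0 add.commute)
    also have "(!) xs ` (+) ?l ` {..<length (ps ! p)} = (!) (ps ! p) ` {..<length (ps ! p)}"
      unfolding image_image by (rule image_cong) (use nth in auto)
    also have "\<dots> = set (ps ! p)" by (auto simp: set_conv_nth)
    finally show ?thesis using set_ps[OF p] by simp
  qed
  with perm show "\<exists>\<pi>. \<pi> permutes {..<n} \<and> (\<forall>p<length L. \<pi> ` block_range ns p = V (L ! p))" by blast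
qed

lemma pick_atLeastLessThan:
  assumes "l + i < u"
  shows "pick {l..<u} i = l + i"
proof -
  have "{x \<in> {l..<u}. x < l + i} = {l..<l + i}" using assms by auto
  then show ?thesis using pick_card_in_set[of "l + i" "{l..<u}"] assms by simp
qed

lemma submatrix_permute_block:
  fixes \<pi> :: "nat \<Rightarrow> nat"
  assumes "A \<in> carrier_mat n n" "u \<le> n" "l \<le> u"
  defines "B \<equiv> submatrix (permute_mat \<pi> A) {l..<u} {l..<u}"
  shows "B \<in> carrier_mat (u - l) (u - l)"
    and "i < u - l \<Longrightarrow> j < u - l \<Longrightarrow> B $$ (i, j) = A $$ (\<pi> (l + i), \<pi> (l + j))"
proof -
  have c: "{x. x < n \<and> x \<in> {l..<u}} = {l..<u}" using assms by auto
  then have B: "B = mat (u - l) (u - l) (\<lambda>(i, j). permute_mat \<pi> A $$ (pick {l..<u} i, pick {l..<u} j))"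
    using assms(1) by (simp add: B_def submatrix_def permute_mat_def del: atLeastLessThan_iff)
  show "B \<in> carrier_mat (u - l) (u - l)" by (simp add: B)
  show "B $$ (i, j) = A $$ (\<pi> (l + i), \<pi> (l + j))" if "i < u - l" "j < u - l"
    using that assms(1,2) by (simp add: B pick_atLeastLessThan permute_mat_def)
qed

section \<open>Real stable determinants\<close>

theorem corollary7p3:
  fixes n :: nat and A :: "complex mat" and f :: mpoly
  assumes "A \<in> carrier_mat n n"
    and "f = det (diag_plus A)"
    and "real_stable n f"
  shows
    "(mpoly_irreducible n f \<longrightarrow>
        (\<exists>H \<in> carrier_mat n n.
           hermitian_mat H \<and> irreducible_mat H \<and> diag_equiv A H \<and>
           (\<forall>S \<subseteq> {..<n}. det (submatrix H S S) = det (submatrix A S S)))) \<and>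
     (\<forall>fs :: mpoly list.
        f = prod_list fs \<and> (\<forall>g \<in> set fs. mpoly_irreducible n g \<and> top_normalized g) \<longrightarrow>
        (\<exists>\<pi> ns \<sigma>.
           \<pi> permutes {..<n} \<and> length ns = length fs \<and> \<sigma> permutes {..<length fs} \<and>
           block_upper_triangular ns (permute_mat \<pi> A) \<and>
           (\<forall>p < length fs.
              let B = submatrix (permute_mat \<pi> A) (block_range ns p) (block_range ns p) in
                irreducible_mat B \<and>
                (\<exists>H. hermitian_mat H \<and> irreducible_mat H \<and> diag_equiv B H) \<and>
                det_poly A (\<pi> ` block_range ns p) = fs ! \<sigma> p)))"
proof (intro conjI impI allI)
  note A = assms(1)
  have ray: "rayleigh {..<n} (entry A)"
    using real_stable_imp_rayleigh[OF A] assms(2,3) by simp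
  have f: "f = det_poly A {..<n}" using assms(2) det_diag_plus[OF A] by simp
  {
    assume "mpoly_irreducible n f"
    then have conn: "strongly_connected {..<n} (entry A)"
      using irreducible_det_poly_imp_strongly_connected[OF A subset_refl] f by simp
    have "hermitizable {..<n} (entry A)"
      by (rule rayleigh_imp_hermitizable[OF _ ray conn]) simp
    from hermitizable_imp_diag_equiv_hermitian[OF A this conn]
    show "\<exists>H \<in> carrier_mat n n.
           hermitian_mat H \<and> irreducible_mat H \<and> diag_equiv A H \<and>
           (\<forall>S \<subseteq> {..<n}. det (submatrix H S S) = det (submatrix A S S))" by metis
  }
  fix fs :: "mpoly list"
  assume "f = prod_list fs \<and> (\<forall>g \<in> set fs. mpoly_irreducible n g \<and> top_normalized g)"
  then have fs: "f = prod_list fs"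
    and irr: "\<And>q. q < length fs \<Longrightarrow> mpoly_irreducible n (fs ! q)"
    and top: "\<And>q. q < length fs \<Longrightarrow> top_normalized (fs ! q)" by auto
  let ?s = "length fs"
  define V where "V q = {k. 0 < degx k (fs ! q)}" for q
  have mp: "fs ! q \<in> mpolys n" if "q < ?s" for q using irr[OF that] by (simp add: mpoly_irreducible_def)
  then have mps: "set fs \<subseteq> mpolys n" by (metis in_set_conv_nth subsetI)
  have nz: "0 \<notin> set fs" using irr by (metis in_set_conv_nth mpoly_irreducible_def)
  have fac: "V q \<subseteq> {..<n}" "fs ! q = det_poly A (V q)"
    "\<And>i j. i \<in> V q \<Longrightarrow> j \<in> {..<n} - V q \<Longrightarrow> entry A i j * entry A j i = 0" if q: "q < ?s" for q
  proof -
    let ?r = "prod_list (take q fs @ drop (Suc q) fs)"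
    have "prod_list (take q fs @ fs ! q # drop (Suc q) fs) = fs ! q * ?r"
      by (simp add: mult.left_commute)
    then have eq: "det_poly A {..<n} = fs ! q * ?r"
      using f fs id_take_nth_drop[OF q] by simp
    have r: "?r \<in> mpolys n"
      by (rule prod_list_in_mpolys) (use mps set_take_subset set_drop_subset in fastforce)
    note * = factor_of_det_poly[OF A eq mp[OF q] r top[OF q], folded V_def]
    show "V q \<subseteq> {..<n}" "fs ! q = det_poly A (V q)"
      "\<And>i j. i \<in> V q \<Longrightarrow> j \<in> {..<n} - V q \<Longrightarrow> entry A i j * entry A j i = 0"
      by (fact *)+
  qed
  (* The degrees of the factors in a variable add up to 1, so each variable belongs to exactly one V q. *)
  have one: "\<exists>q<?s. k \<in> V q \<and> (\<forall>r<?s. q \<noteq> r \<longrightarrow> k \<notin> V r)" if "k < n" for k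
  proof -
    have "(\<Sum>q<?s. degx k (fs ! q)) = 1"
    proof -
      have "degx k f = 1" using f degx_det_poly[OF A subset_refl, of k] that by simp
      then show ?thesis by (simp add: fs degx_prod_list[OF nz] sum_list_sum_nth atLeast0LessThan)
    qed
    then show ?thesis by (auto simp: sum_eq_Suc0_iff V_def)
  qed
  have disj: "V q \<inter> V r = {}" if "q < ?s" "r < ?s" "q \<noteq> r" for q r
  proof (rule ccontr)
    assume "V q \<inter> V r \<noteq> {}"
    then obtain k where k: "k \<in> V q" "k \<in> V r" by blast
    then have "k < n" using fac(1)[OF that(1)] by auto
    from one[OF this] show False using k that by metis
  qed
  have cover: "(\<Union>q\<in>{..<?s}. V q) = {..<n}" using one fac(1) by fastforce
  have ne: "V q \<noteq> {}" if q: "q < ?s" for q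
  proof
    assume "V q = {}"
    then have "mpoly_unit n (fs ! q)"
      using mpoly_constant_unit[OF _ mp[OF q]] irr[OF q] by (auto simp: V_def mpoly_irreducible_def)
    then show False using irr[OF q] by (simp add: mpoly_irreducible_def)
  qed
  have conn: "strongly_connected (V q) (entry A)" if "q < ?s" for q
    using irreducible_det_poly_imp_strongly_connected[OF A fac(1)[OF that]] irr[OF that] fac(2)[OF that] by simp
  have finV: "finite (V q)" if "q < ?s" for q using fac(1)[OF that] finite_subset by blast
  have herm: "hermitizable (V q) (entry A)" if "q < ?s" for q
    by (rule rayleigh_imp_hermitizable[OF finV[OF that] rayleigh_subset[OF _ ray fac(1)[OF that]] conn[OF that]]) simp
  (* E q r: no edge leads from block q to block r. *)
  define E where "E q r \<longleftrightarrow> (\<forall>i\<in>V q. \<forall>j\<in>V r. entry A i j = 0)" for q r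
  have "\<exists>q\<in>J. \<forall>r\<in>J - {q}. E q r" if J: "J \<subseteq> {..<?s}" "J \<noteq> {}" for J
  proof -
    have s: "q < ?s" if "q \<in> J" for q using that J(1) by auto
    have cross: "entry A i j * entry A j i = 0"
      if "q \<in> J" "r \<in> J" "q \<noteq> r" "i \<in> V q" "j \<in> V r" for q r i j
    proof (rule fac(3)[OF s[OF that(1)] that(4)])
      show "j \<in> {..<n} - V q"
        using fac(1)[OF s[OF that(2)]] disj[OF s[OF that(1)] s[OF that(2)] that(3)] that(5) by blast
    qed
    obtain q where "q \<in> J" "\<And>r i j. r \<in> J - {q} \<Longrightarrow> i \<in> V q \<Longrightarrow> j \<in> V r \<Longrightarrow> entry A i j = 0"
    proof (rule ex_sink_block[of "{..<n}" "entry A" J V])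
      show "V q \<subseteq> {..<n}" "V q \<noteq> {}" "strongly_connected (V q) (entry A)" if "q \<in> J" for q
        using fac(1)[OF s[OF that]] ne[OF s[OF that]] conn[OF s[OF that]] by simp_all
      show "V q \<inter> V r = {}" if "q \<in> J" "r \<in> J" "q \<noteq> r" for q r
        using disj[OF s[OF that(1)] s[OF that(2)] that(3)] .
    qed (use ray J(2) cross in auto)
    then show ?thesis unfolding E_def by blast
  qed
  then obtain L where L: "distinct L" "set L = {..<?s}"
    and ord: "\<And>p q. p < length L \<Longrightarrow> q < p \<Longrightarrow> E (L ! p) (L ! q)"
    using ex_block_order[of "{..<?s}" E] by (metis finite_lessThan)
  have lenL: "length L = ?s" using distinct_card[OF L(1)] L(2) by simp
  have Lp: "L ! p < ?s" if "p < ?s" for p using nth_mem[of p L] that L(2) lenL by auto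
  define ns where "ns = map (\<lambda>q. card (V q)) L"
  note blocks = ex_permutation_to_blocks[OF L, of V n, folded ns_def]
  have sum: "sum_list ns = n"
    by (rule blocks(1)) (use finV cover disj ne in auto)
  have "\<exists>\<pi>. \<pi> permutes {..<n} \<and> (\<forall>p<length L. \<pi> ` block_range ns p = V (L ! p))"
    by (rule blocks(2)) (use finV cover disj ne in auto)
  then obtain \<pi> where pi: "\<pi> permutes {..<n}" and im: "\<And>p. p < ?s \<Longrightarrow> \<pi> ` block_range ns p = V (L ! p)"
    using lenL by auto
  define \<sigma> where "\<sigma> p = (if p < ?s then L ! p else p)" for p
  have "\<sigma> permutes {..<?s}"
    using permutes_of_list[OF L] by (simp add: \<sigma>_def[abs_def])
  have lns: "length ns = ?s" by (simp add: ns_def lenL)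
  have range: "block_range ns p = {sum_list (take p ns)..<sum_list (take p ns) + card (V (L ! p))}"
    "sum_list (take p ns) + card (V (L ! p)) \<le> n" if "p < ?s" for p
  proof -
    have e: "sum_list (take (Suc p) ns) = sum_list (take p ns) + card (V (L ! p))"
      using that lns lenL by (simp add: take_Suc_conv_app_nth ns_def)
    then show "block_range ns p = {sum_list (take p ns)..<sum_list (take p ns) + card (V (L ! p))}"
      by (simp add: block_range_def)
    have "sum_list ns = sum_list (take (Suc p) ns) + sum_list (drop (Suc p) ns)"
      by (metis append_take_drop_id sum_list_append)
    then show "sum_list (take p ns) + card (V (L ! p)) \<le> n" using e sum by simp
  qed
  have "block_upper_triangular ns (permute_mat \<pi> A)"
    unfolding block_upper_triangular_def
  proof (intro conjI allI impI ballI)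
    show "permute_mat \<pi> A \<in> carrier_mat (sum_list ns) (sum_list ns)"
      using A sum by (simp add: permute_mat_def)
    show "0 < k" if "k \<in> set ns" for k
    proof -
      have "k \<in> (\<lambda>q. card (V q)) ` {..<?s}" using that L(2) by (simp add: ns_def)
      then obtain q where "q < ?s" "k = card (V q)" by blast
      then show ?thesis using ne[of q] finV[of q] by (simp add: card_gt_0_iff)
    qed
    fix p q i j assume pq: "p < length ns" "q < p" and i: "i \<in> block_range ns p" and j: "j \<in> block_range ns q"
    have ps: "p < ?s" "q < ?s" using pq lns by auto
    have "\<pi> i \<in> V (L ! p)" "\<pi> j \<in> V (L ! q)" using im ps i j by blast+
    then have "A $$ (\<pi> i, \<pi> j) = 0" using ord[of p q] pq lns lenL by (simp add: E_def)
    moreover have "i < n" "j < n" using range[OF ps(1)] range[OF ps(2)] i j by auto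
    ultimately show "permute_mat \<pi> A $$ (i, j) = 0" using A by (simp add: permute_mat_def)
  qed
  moreover have "let B = submatrix (permute_mat \<pi> A) (block_range ns p) (block_range ns p) in
      irreducible_mat B \<and> (\<exists>H. hermitian_mat H \<and> irreducible_mat H \<and> diag_equiv B H) \<and>
      det_poly A (\<pi> ` block_range ns p) = fs ! \<sigma> p" if p: "p < ?s" for p
  proof -
    let ?l = "sum_list (take p ns)" and ?m = "card (V (L ! p))"
    define B where "B = submatrix (permute_mat \<pi> A) (block_range ns p) (block_range ns p)"
    have B: "B \<in> carrier_mat ?m ?m"
      and Bij: "\<And>i j. i < ?m \<Longrightarrow> j < ?m \<Longrightarrow> entry B i j = entry A (\<pi> (?l + i)) (\<pi> (?l + j))"
      using submatrix_permute_block[OF A range(2)[OF p], where l = ?l and \<pi> = \<pi>] by (simp_all add: B_def range(1)[OF p])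
    have bij: "bij_betw (\<lambda>i. \<pi> (?l + i)) {..<?m} (V (L ! p))"
    proof -
      have "(\<lambda>i. \<pi> (?l + i)) ` {..<?m} = \<pi> ` (+) ?l ` {..<?m}" by (simp add: image_image)
      also have "(+) ?l ` {..<?m} = block_range ns p"
        by (simp add: range(1)[OF p] lessThan_atLeast0 add.commute)
      finally have "(\<lambda>i. \<pi> (?l + i)) ` {..<?m} = V (L ! p)" using im[OF p] by simp
      moreover have "inj_on (\<lambda>i. \<pi> (?l + i)) {..<?m}"
      proof (rule inj_onI)
        fix a b assume "\<pi> (?l + a) = \<pi> (?l + b)"
        then have "?l + a = ?l + b" by (rule injD[OF permutes_inj[OF pi]])
        then show "a = b" by simp
      qed
      ultimately show ?thesis by (simp add: bij_betw_def)
    qed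
    have connB: "strongly_connected {..<?m} (entry B)"
      by (rule strongly_connected_transport[OF conn[OF Lp[OF p]] bij Bij])
    have "hermitizable {..<?m} (entry B)"
      by (rule hermitizable_transport[OF herm[OF Lp[OF p]] _ Bij]) (use bij in \<open>auto simp: bij_betw_def\<close>)
    from hermitizable_imp_diag_equiv_hermitian[OF B this connB]
    obtain H where "hermitian_mat H" "irreducible_mat H" "diag_equiv B H" by metis
    moreover have "irreducible_mat B" by (rule strongly_connected_imp_irreducible_mat[OF B connB])
    moreover have "det_poly A (\<pi> ` block_range ns p) = fs ! \<sigma> p"
      using im[OF p] fac(2)[OF Lp[OF p]] p by (simp add: \<sigma>_def)
    ultimately show ?thesis unfolding B_def Let_def by blast
  qed
  ultimately show "\<exists>\<pi> ns \<sigma>.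
           \<pi> permutes {..<n} \<and> length ns = length fs \<and> \<sigma> permutes {..<length fs} \<and>
           block_upper_triangular ns (permute_mat \<pi> A) \<and>
           (\<forall>p < length fs.
              let B = submatrix (permute_mat \<pi> A) (block_range ns p) (block_range ns p) in
                irreducible_mat B \<and>
                (\<exists>H. hermitian_mat H \<and> irreducible_mat H \<and> diag_equiv B H) \<and>
                det_poly A (\<pi> ` block_range ns p) = fs ! \<sigma> p)"
    using pi \<open>\<sigma> permutes {..<?s}\<close> lns by blast
qed

end
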